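(* The natural maps $\xi_{a_\bullet}\mapsto \widehat d_{a_\bullet}$ and $\xi_{a_\bullet}\mapsto d_{a_\bullet}$ induce ring isomorphisms $$\text{(i)}\quad \widehat{k[\delta_\infty]}\cong\widehat{k[\xi_{a_\bullet}]}/\widehat P,\qquad\qquad \text{(ii)}\quad k[\delta_\infty]\cong k[\xi_{a_\bullet}]/P .$$
   Context: $k$ is an algebraically closed field of characteristic $0$; $m,n$ are positive integers. Let $k[a_{i,j}]_{m,n}$ be the polynomial ring in variables $a_{i,j}$, $-m\le i,j\le n-1$. For $-m\le l_0<\dots<l_{m-1}\le n-1$, $d_{l_0\dots l_{m-1}}$ is the determinant of the minor with rows $l_0,\dots,l_{m-1}$ and columns $-m,\dots,-1$; $k[\delta_{m,n}]$ is the $k$-subalgebra generated by these determinants. For $m'\ge m$, $n'\ge n$: $e_{(m',n',m,n)}:k[\delta_{m',n'}]\to k[\delta_{m,n}]$ sends $d_{-m',\dots,-m-1,l_0,\dots,l_{m-1}}$ (with $-m\le l_0<\dots<l_{m-1}\le n-1$) to $d_{l_0\dots l_{m-1}}$ and all other generators to $0$; $r_{(m,n,m',n')}:k[\delta_{m,n}]\to k[\delta_{m',n'}]$ sends $d_{l_0\dots l_{m-1}}$ to $d_{-m',\dots,-m-1,l_0,\dots,l_{m-1}}$. $\widehat{k[\delta_\infty]}=\varprojlim k[\delta_{m,n}]$ via the $e$'s, $k[\delta_\infty]=\varinjlim k[\delta_{m,n}]$ via the $r$'s. A Maya diagram (of virtual cardinality $0$) is a strictly increasing sequence of integers $a_\bullet=(a_i)_{i\ge1}$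 with $a_i=i$ for $i\gg0$. Those with $a_i=i$ for $i>m$ and $a_1\ge 1-n$ (say: of type $(m,n)$) correspond to index sets $-m\le l_0<\dots<l_{m-1}\le n-1$ by $(l_0,\dots,l_{m-1})=(-a_m,\dots,-a_1)$; write $d_{a_{\le m}}=d_{l_0\dots l_{m-1}}$. $d_{a_\bullet}\in k[\delta_\infty]$ is the class of $d_{a_{\le m}}$; $\widehat d_{a_\bullet}\in\widehat{k[\delta_\infty]}$ has $(m,n)$ component $d_{a_{\le m}}$ if $a_\bullet$ is of type $(m,n)$ and $0$ otherwise. $k[\xi_{a_\bullet}]$ is the polynomial ring over $k$ in independent variables $\xi_{a_\bullet}$, one for each Maya diagram. Let $S_{(m,n)}\subset k[\xi_{a_\bullet}]$ be the polynomial subring on the variables of type $(m,n)$; thus $k[\xi_{a_\bullet}]=\bigcup S_{(m,n)}$. For $m'\ge m$, $n'\ge n$ let $S_{(m',n')}\to S_{(m,n)}$ be the surjection fixing the variables of type $(m,n)$ and sending the other variables to $0$; $\widehat{k[\xi_{a_\bullet}]}=\varprojlim S_{(m,n)}$. $P_{(m,n)}\subset S_{(m,n)}$ is the ideal of Plücker relations, i.e. the kernel of $S_{(m,n)}\to k[\delta_{m,n}]$, $\xi_{a_\bullet}\mapsto d_{a_{\le m}}$. $P=\bigcup P_{(m,n)}\subset k[\xi_{a_\bullet}]$ and $\widehat P=\varprojlim P_{(m,n)}\subset\widehat{k[\xi_{a_\bullet}]}$. The natural map $\widehat{k[\xi_{a_\bullet}]}\to\widehat{k[\delta_\infty]}$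 is the inverse limit of the maps $S_{(m,n)}\to k[\delta_{m,n}]$. *)

theory Defs
  imports
    "Jordan_Normal_Form.Determinant"
    "HOL-Library.Poly_Mapping"
    "HOL-Algebra.QuotRing"
    "HOL-Algebra.Generated_Rings"
begin

section \<open>Polynomials over an arbitrary set of variables\<close>

text \<open>Monomials are finitely supported exponent functions; sums, products and the
  commutative ring structure are those of \<^theory>\<open>HOL-Library.Poly_Mapping\<close>.\<close>

type_synonym ('v, 'k) mpoly = "('v \<Rightarrow>\<^sub>0 nat) \<Rightarrow>\<^sub>0 'k"

definition pconst :: "'k::comm_ring_1 \<Rightarrow> ('v, 'k) mpoly" where
  "pconst c = Poly_Mapping.single 0 c"

definition pvar :: "'v \<Rightarrow> ('v, 'k::comm_ring_1) mpoly" where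
  "pvar v = Poly_Mapping.single (Poly_Mapping.single v 1) 1"

definition pvars :: "('v, 'k::comm_ring_1) mpoly \<Rightarrow> 'v set" where
  "pvars p = (\<Union>t \<in> Poly_Mapping.keys p. Poly_Mapping.keys t)"

definition psubst ::
    "('v \<Rightarrow> ('w, 'k) mpoly) \<Rightarrow> ('v, 'k::comm_ring_1) mpoly \<Rightarrow> ('w, 'k) mpoly" where
  "psubst s p = (\<Sum>t \<in> Poly_Mapping.keys p. pconst (Poly_Mapping.lookup p t) *
     (\<Prod>v \<in> Poly_Mapping.keys t. s v ^ Poly_Mapping.lookup t v))"

definition poly_ring :: "'v set \<Rightarrow> ('v, 'k::comm_ring_1) mpoly ring" where
  "poly_ring V = \<lparr>carrier = {p. pvars p \<subseteq> V}, mult = (*), one = 1, zero = 0, add = (+)\<rparr>"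

text \<open>Homomorphisms of \<open>k\<close>-algebras realised inside polynomial rings; they are required to be
  extensional so that they are determined by their values on the carrier.\<close>

definition poly_alg_hom ::
    "('v, 'k::comm_ring_1) mpoly ring \<Rightarrow> ('w, 'k) mpoly ring \<Rightarrow>
      (('v, 'k) mpoly \<Rightarrow> ('w, 'k) mpoly) set" where
  "poly_alg_hom A B =
     {f \<in> ring_hom A B. f \<in> extensional (carrier A) \<and> (\<forall>c. f (pconst c) = pconst c)}"


section \<open>Inverse and direct limits of rings\<close>

text \<open>For \<open>i \<le> j\<close> the transition map \<open>f j i\<close> of an inverse system goes from \<open>R j\<close> to \<open>R i\<close>,
  and the transition map \<open>f i j\<close> of a direct system goes from \<open>R i\<close> to \<open>R j\<close>.\<close>

definition inv_limit ::
    "'i set \<Rightarrow> ('i \<Rightarrow> 'i \<Rightarrow> bool) \<Rightarrow> ('i \<Rightarrow> 'a ring) \<Rightarrow> ('i \<Rightarrow> 'i \<Rightarrow> 'a \<Rightarrow> 'a) \<Rightarrow> ('i \<Rightarrow> 'a) ring" where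
  "inv_limit I leq R f =
    \<lparr>carrier = {x \<in> (\<Pi>\<^sub>E i\<in>I. carrier (R i)). \<forall>i\<in>I. \<forall>j\<in>I. leq i j \<longrightarrow> f j i (x j) = x i},
     mult = (\<lambda>x y. \<lambda>i\<in>I. x i \<otimes>\<^bsub>R i\<^esub> y i),
     one = (\<lambda>i\<in>I. \<one>\<^bsub>R i\<^esub>),
     zero = (\<lambda>i\<in>I. \<zero>\<^bsub>R i\<^esub>),
     add = (\<lambda>x y. \<lambda>i\<in>I. x i \<oplus>\<^bsub>R i\<^esub> y i)\<rparr>"

definition dir_class ::
    "'i set \<Rightarrow> ('i \<Rightarrow> 'i \<Rightarrow> bool) \<Rightarrow> ('i \<Rightarrow> 'a ring) \<Rightarrow> ('i \<Rightarrow> 'i \<Rightarrow> 'a \<Rightarrow> 'a) \<Rightarrow>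
      'i \<Rightarrow> 'a \<Rightarrow> ('i \<times> 'a) set" where
  "dir_class I leq R f i x =
    {(j, y). j \<in> I \<and> y \<in> carrier (R j) \<and> (\<exists>k\<in>I. leq i k \<and> leq j k \<and> f i k x = f j k y)}"

text \<open>As is usual for quotients, an operation on classes is the union of the resulting classes
  over all representatives; for a directed system all the classes in the union coincide.\<close>

definition dir_limit ::
    "'i set \<Rightarrow> ('i \<Rightarrow> 'i \<Rightarrow> bool) \<Rightarrow> ('i \<Rightarrow> 'a ring) \<Rightarrow> ('i \<Rightarrow> 'i \<Rightarrow> 'a \<Rightarrow> 'a) \<Rightarrow>
      ('i \<times> 'a) set ring" where
  "dir_limit I leq R f =
    (let cls = dir_class I leq R f in
    \<lparr>carrier = (\<Union>i\<in>I. cls i ` carrier (R i)),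
     mult = (\<lambda>X Y. \<Union>(i, x)\<in>X. \<Union>(j, y)\<in>Y. \<Union>k\<in>{k\<in>I. leq i k \<and> leq j k}.
               cls k (f i k x \<otimes>\<^bsub>R k\<^esub> f j k y)),
     one = (\<Union>i\<in>I. cls i \<one>\<^bsub>R i\<^esub>),
     zero = (\<Union>i\<in>I. cls i \<zero>\<^bsub>R i\<^esub>),
     add = (\<lambda>X Y. \<Union>(i, x)\<in>X. \<Union>(j, y)\<in>Y. \<Union>k\<in>{k\<in>I. leq i k \<and> leq j k}.
               cls k (f i k x \<oplus>\<^bsub>R k\<^esub> f j k y))\<rparr>)"

definition induces_ring_iso ::
    "('a \<Rightarrow> 'b) \<Rightarrow> 'a ring \<Rightarrow> 'a set \<Rightarrow> 'b ring \<Rightarrow> bool" where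
  "induces_ring_iso h R I S \<longleftrightarrow> h \<in> ring_hom R S \<and> ideal I R \<and>
     (\<exists>\<Phi> \<in> ring_iso (R Quot I) S. \<forall>x \<in> carrier R. \<Phi> (I +>\<^bsub>R\<^esub> x) = h x)"

definition idx_pairs :: "(nat \<times> nat) set" where
  "idx_pairs = {(m, n). 1 \<le> m \<and> 1 \<le> n}"

definition idx_le :: "nat \<times> nat \<Rightarrow> nat \<times> nat \<Rightarrow> bool" where
  "idx_le i j \<longleftrightarrow> fst i \<le> fst j \<and> snd i \<le> snd j"


section \<open>The algebras generated by maximal minors, and their limits\<close>

definition entry_ring :: "nat \<Rightarrow> nat \<Rightarrow> (int \<times> int, 'k::comm_ring_1) mpoly ring" where
  "entry_ring m n = poly_ring ({- int m..int n - 1} \<times> {- int m..int n - 1})"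

definition row_lists :: "nat \<Rightarrow> nat \<Rightarrow> int list set" where
  "row_lists m n =
     {ls. length ls = m \<and> sorted_wrt (<) ls \<and> set ls \<subseteq> {- int m..int n - 1}}"

definition minor :: "nat \<Rightarrow> int list \<Rightarrow> (int \<times> int, 'k::comm_ring_1) mpoly" where
  "minor m ls = Determinant.det (mat m m (\<lambda>(r, c). pvar (ls ! r, int c - int m)))"

definition minor_alg :: "nat \<Rightarrow> nat \<Rightarrow> (int \<times> int, 'k::comm_ring_1) mpoly ring" where
  "minor_alg m n = (entry_ring m n)
     \<lparr>carrier := generate_ring (entry_ring m n) (range pconst \<union> minor m ` row_lists m n)\<rparr>"

definition pad :: "nat \<Rightarrow> nat \<Rightarrow> int list \<Rightarrow> int list" where
  "pad m' m ls = [- int m'..- int m - 1] @ ls"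

definition e_map :: "nat \<Rightarrow> nat \<Rightarrow> nat \<Rightarrow> nat \<Rightarrow>
    (int \<times> int, 'k::comm_ring_1) mpoly \<Rightarrow> (int \<times> int, 'k) mpoly" where
  "e_map m' n' m n = (THE f. f \<in> poly_alg_hom (minor_alg m' n') (minor_alg m n) \<and>
     (\<forall>ls \<in> row_lists m n. f (minor m' (pad m' m ls)) = minor m ls) \<and>
     (\<forall>ls \<in> row_lists m' n' - pad m' m ` row_lists m n. f (minor m' ls) = 0))"

definition r_map :: "nat \<Rightarrow> nat \<Rightarrow> nat \<Rightarrow> nat \<Rightarrow>
    (int \<times> int, 'k::comm_ring_1) mpoly \<Rightarrow> (int \<times> int, 'k) mpoly" where
  "r_map m n m' n' = (THE f. f \<in> poly_alg_hom (minor_alg m n) (minor_alg m' n') \<and>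
     (\<forall>ls \<in> row_lists m n. f (minor m ls) = minor m' (pad m' m ls)))"

definition delta_hat :: "(nat \<times> nat \<Rightarrow> (int \<times> int, 'k::comm_ring_1) mpoly) ring" where
  "delta_hat = inv_limit idx_pairs idx_le (\<lambda>(m, n). minor_alg m n)
     (\<lambda>(m', n') (m, n). e_map m' n' m n)"

definition delta_class :: "nat \<Rightarrow> nat \<Rightarrow> (int \<times> int, 'k::comm_ring_1) mpoly \<Rightarrow>
    ((nat \<times> nat) \<times> (int \<times> int, 'k) mpoly) set" where
  "delta_class m n = dir_class idx_pairs idx_le (\<lambda>(m, n). minor_alg m n)
     (\<lambda>(m, n) (m', n'). r_map m n m' n') (m, n)"

definition delta_infty :: "((nat \<times> nat) \<times> (int \<times> int, 'k::comm_ring_1) mpoly) set ring" where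
  "delta_infty = dir_limit idx_pairs idx_le (\<lambda>(m, n). minor_alg m n)
     (\<lambda>(m, n) (m', n'). r_map m n m' n')"


section \<open>Maya diagrams\<close>

text \<open>The sequence \<open>a\<^sub>1, a\<^sub>2, \<dots>\<close> is indexed from zero: \<open>maya_seq a i\<close> is \<open>a\<^sub>i\<^sub>+\<^sub>1\<close>.\<close>

typedef maya = "{a :: nat \<Rightarrow> int. strict_mono a \<and> (\<exists>N. \<forall>i\<ge>N. a i = int i + 1)}"
  morphisms maya_seq Abs_maya
  by (rule exI[of _ "\<lambda>i. int i + 1"]) (simp add: strict_mono_def)

definition maya_type :: "nat \<Rightarrow> nat \<Rightarrow> maya set" where
  "maya_type m n = {a. (\<forall>i\<ge>m. maya_seq a i = int i + 1) \<and> 1 - int n \<le> maya_seq a 0}"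

text \<open>The list \<open>(- a\<^sub>m, \<dots>, - a\<^sub>1)\<close>.\<close>

definition maya_rows :: "nat \<Rightarrow> maya \<Rightarrow> int list" where
  "maya_rows m a = map (\<lambda>j. - maya_seq a (m - 1 - j)) [0..<m]"

definition d_maya :: "nat \<Rightarrow> maya \<Rightarrow> (int \<times> int, 'k::comm_ring_1) mpoly" where
  "d_maya m a = minor m (maya_rows m a)"

definition d_hat :: "maya \<Rightarrow> nat \<times> nat \<Rightarrow> (int \<times> int, 'k::comm_ring_1) mpoly" where
  "d_hat a = (\<lambda>(m, n) \<in> idx_pairs. if a \<in> maya_type m n then d_maya m a else 0)"

text \<open>The class does not depend on the chosen type \<open>(m, n)\<close> of the diagram; the same
  convention as for the constants of the direct limit is used.\<close>

definition d_infty :: "maya \<Rightarrow> ((nat \<times> nat) \<times> (int \<times> int, 'k::comm_ring_1) mpoly) set" where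
  "d_infty a = (\<Union>(m, n) \<in> {(m, n) \<in> idx_pairs. a \<in> maya_type m n}. delta_class m n (d_maya m a))"

definition const_infty :: "'k::comm_ring_1 \<Rightarrow> ((nat \<times> nat) \<times> (int \<times> int, 'k) mpoly) set" where
  "const_infty c = (\<Union>(m, n) \<in> idx_pairs. delta_class m n (pconst c))"


section \<open>The polynomial ring on Maya diagrams and the Pluecker relations\<close>

definition xi_ring :: "(maya, 'k::comm_ring_1) mpoly ring" where
  "xi_ring = poly_ring UNIV"

definition S_ring :: "nat \<Rightarrow> nat \<Rightarrow> (maya, 'k::comm_ring_1) mpoly ring" where
  "S_ring m n = poly_ring (maya_type m n)"

definition S_proj :: "nat \<Rightarrow> nat \<Rightarrow> (maya, 'k::comm_ring_1) mpoly \<Rightarrow> (maya, 'k) mpoly" where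
  "S_proj m n = psubst (\<lambda>a. if a \<in> maya_type m n then pvar a else 0)"

definition xi_hat :: "(nat \<times> nat \<Rightarrow> (maya, 'k::comm_ring_1) mpoly) ring" where
  "xi_hat = inv_limit idx_pairs idx_le (\<lambda>(m, n). S_ring m n) (\<lambda>_ (m, n). S_proj m n)"

definition S_to_minor :: "nat \<Rightarrow> (maya, 'k::comm_ring_1) mpoly \<Rightarrow> (int \<times> int, 'k) mpoly" where
  "S_to_minor m = psubst (d_maya m)"

definition pluecker :: "nat \<Rightarrow> nat \<Rightarrow> (maya, 'k::comm_ring_1) mpoly set" where
  "pluecker m n = a_kernel (S_ring m n) (minor_alg m n) (S_to_minor m)"

definition P_infty :: "(maya, 'k::comm_ring_1) mpoly set" where
  "P_infty = (\<Union>(m, n) \<in> idx_pairs. pluecker m n)"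

definition P_hat :: "(nat \<times> nat \<Rightarrow> (maya, 'k::comm_ring_1) mpoly) set" where
  "P_hat = {x \<in> carrier xi_hat. \<forall>(m, n) \<in> idx_pairs. x (m, n) \<in> pluecker m n}"

definition xi_hat_var :: "maya \<Rightarrow> nat \<times> nat \<Rightarrow> (maya, 'k::comm_ring_1) mpoly" where
  "xi_hat_var a = (\<lambda>(m, n) \<in> idx_pairs. if a \<in> maya_type m n then pvar a else 0)"

definition nat_map_hat :: "(nat \<times> nat \<Rightarrow> (maya, 'k::comm_ring_1) mpoly) \<Rightarrow>
    nat \<times> nat \<Rightarrow> (int \<times> int, 'k) mpoly" where
  "nat_map_hat x = (\<lambda>(m, n) \<in> idx_pairs. S_to_minor m (x (m, n)))"

end

(* Let phi_m be the evaluation of the Maya variables at the minors, so that k[delta_{m,n}] is the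
   quotient of S_{m,n} by the Pluecker relations. Everything rests on two facts about relations.
   (E) A relation of type (m',n') stays one when the variables not of type (m,n) are set to 0: specialise
   the generic matrix to an identity block on the indices below -m and to zero rows from n on.
   (R) A relation of type (m,n) is one of type (m',n'): over the fraction field, the padded minors are,
   by Schur complement, the minors of another m-column matrix up to a common factor.
   So e and r are induced by the projections and inclusions of the rings S_{m,n}, and the relations of
   smaller type embed in those of larger type as a splitting of the projection. The latter gives (ii) and
   the Mittag-Leffler condition needed for surjectivity in (i). *)

theory Submission
  imports Defs "HOL-Library.Product_Lexorder" "HOL-Computational_Algebra.Polynomial_Factorial"
begin

text \<open>The facts (E) and (R) differ in kind. (E) passes from a larger generic matrix to a
  smaller one and is a substitution inside polynomial rings. (R) goes the other way: minors with
  more columns must appear as minors of a matrix with only m columns, and the Schur complement that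
  achieves this has a determinant in its denominators. Hence evaluation is developed with values in
  an arbitrary commutative ring, and fractions are removed only at the end. The condition m >= 1 in
  \<open>idx_pairs\<close> is essential for (R): for m = 0 the only minor is 1, while the padded one
  is a nonconstant determinant. No explicit quadratic relations occur; a relation is any polynomial
  that vanishes at the minors. Since \<open>e_map\<close> and \<open>r_map\<close> are definite
  descriptions, nothing is known of them until existence is derived from (E) and (R), and uniqueness
  from the generators.\<close>

section \<open>Evaluation of polynomials\<close>

text \<open>Unlike \<open>psubst\<close>, this allows a coefficient map \<open>h\<close> into
  another ring, so that a relation can be evaluated in the fraction field of a polynomial
  ring.\<close>

definition peval :: "('k::comm_ring_1 \<Rightarrow> 'r::comm_ring_1) \<Rightarrow> ('v \<Rightarrow> 'r) \<Rightarrow> ('v, 'k) mpoly \<Rightarrow> 'r" where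
  "peval h s p = (\<Sum>t \<in> Poly_Mapping.keys p. h (Poly_Mapping.lookup p t) *
     (\<Prod>v \<in> Poly_Mapping.keys t. s v ^ Poly_Mapping.lookup t v))"

lemma psubst_eq_peval: "psubst s = peval pconst s"
  by (simp add: fun_eq_iff psubst_def peval_def)

lemma monom_eval_add:
  fixes s :: "'v \<Rightarrow> 'r::comm_ring_1"
  shows "(\<Prod>v \<in> Poly_Mapping.keys (t + u). s v ^ Poly_Mapping.lookup (t + u) v) =
    (\<Prod>v \<in> Poly_Mapping.keys t. s v ^ Poly_Mapping.lookup t v) *
    (\<Prod>v \<in> Poly_Mapping.keys u. s v ^ Poly_Mapping.lookup u v)"
proof -
  let ?A = "Poly_Mapping.keys t \<union> Poly_Mapping.keys u"
  have *: "(\<Prod>v \<in> Poly_Mapping.keys w. s v ^ Poly_Mapping.lookup w v) =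
      (\<Prod>v \<in> ?A. s v ^ Poly_Mapping.lookup w v)"
    if "Poly_Mapping.keys w \<subseteq> ?A" for w
    using that by (intro prod.mono_neutral_left) (auto simp: in_keys_iff)
  show ?thesis
    unfolding *[of "t + u", OF keys_add] *[of t, OF Un_upper1] *[of u, OF Un_upper2]
    by (simp add: lookup_add power_add prod.distrib)
qed

lemma peval_single:
  assumes "h 0 = 0"
  shows "peval h s (Poly_Mapping.single t c) =
    h c * (\<Prod>v \<in> Poly_Mapping.keys t. s v ^ Poly_Mapping.lookup t v)"
  using assms by (cases "c = 0") (simp_all add: peval_def lookup_single)

lemma mpoly_single_induct [case_names zero add]:
  fixes p :: "('v, 'k::comm_ring_1) mpoly"
  assumes "P 0"
    and "\<And>t c p. P p \<Longrightarrow> P (Poly_Mapping.single t c + p)"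
  shows "P p"
proof (induction p rule: update_induct)
  case const
  show ?case by fact
next
  case (update f a b)
  have "Poly_Mapping.update a b f = Poly_Mapping.single a b + f"
    using update(1)
    by (intro poly_mapping_eqI) (auto simp: lookup_update lookup_add lookup_single in_keys_iff when_def)
  then show ?case
    using assms(2) update by simp
qed

lemma peval_hom:
  assumes "comm_ring_hom h"
  shows "comm_ring_hom (peval h s)"
proof -
  interpret h: comm_ring_hom h by fact
  let ?M = "\<lambda>t. \<Prod>v \<in> Poly_Mapping.keys t. s v ^ Poly_Mapping.lookup t v"
  have add: "peval h s (p + q) = peval h s p + peval h s q" for p q
    unfolding peval_def
    by (rule setsum_keys_plus_distrib) (auto simp: h.hom_add algebra_simps)
  have zero: "peval h s 0 = 0"
    by (simp add: peval_def)
  \<comment> \<open>Multiplicativity is reduced to monomials one factor at a time; for two monomials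
    it is \<open>monom_eval_add\<close>.\<close>
  have single: "peval h s (Poly_Mapping.single t c * p) = peval h s (Poly_Mapping.single t c) * peval h s p"
    for t c p
  proof (induction p rule: mpoly_single_induct)
    case zero
    show ?case by (simp add: \<open>peval h s 0 = 0\<close>)
  next
    case (add u d p)
    have "peval h s (Poly_Mapping.single t c * Poly_Mapping.single u d) =
        peval h s (Poly_Mapping.single t c) * peval h s (Poly_Mapping.single u d)"
      by (simp add: mult_single peval_single monom_eval_add h.hom_mult algebra_simps)
    then show ?case
      using add by (simp add: \<open>\<And>p q. peval h s (p + q) = _\<close> distrib_left)
  qed
  have mult: "peval h s (p * q) = peval h s p * peval h s q" for p q
  proof (induction p rule: mpoly_single_induct)
    case zero
    show ?case by (simp add: \<open>peval h s 0 = 0\<close>)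
  next
    case (add u d p)
    then show ?case
      by (simp add: \<open>\<And>p q. peval h s (p + q) = _\<close> distrib_right single)
  qed
  have one: "peval h s 1 = 1"
    by (simp add: peval_def)
  show ?thesis
    by unfold_locales (simp_all add: add mult zero one)
qed

lemma pconst_hom: "comm_ring_hom (pconst :: 'k::comm_ring_1 \<Rightarrow> ('v, 'k) mpoly)"
  by unfold_locales (simp_all add: pconst_def single_add mult_single)

lemma peval_pconst:
  assumes "comm_ring_hom h"
  shows "peval h s (pconst c) = h c"
proof -
  interpret h: comm_ring_hom h by fact
  show ?thesis by (simp add: pconst_def peval_single)
qed

lemma peval_pvar:
  assumes "comm_ring_hom h"
  shows "peval h s (pvar v) = s v"
proof -
  interpret h: comm_ring_hom h by fact
  show ?thesis by (simp add: pvar_def peval_single)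
qed

interpretation pconst: comm_ring_hom "pconst :: 'k::comm_ring_1 \<Rightarrow> ('v, 'k) mpoly"
  by (rule pconst_hom)

interpretation psubst: comm_ring_hom "psubst s" for s :: "'v \<Rightarrow> ('w, 'k::comm_ring_1) mpoly"
  unfolding psubst_eq_peval by (rule peval_hom, rule pconst_hom)

lemma psubst_pconst [simp]: "psubst s (pconst c) = pconst c"
  by (simp add: psubst_eq_peval peval_pconst pconst_hom)

lemma psubst_pvar [simp]: "psubst s (pvar v) = s v"
  by (simp add: psubst_eq_peval peval_pvar pconst_hom)

lemma pvar_power: "pvar v ^ n = (Poly_Mapping.single (Poly_Mapping.single v n) 1 :: ('v, 'k::comm_ring_1) mpoly)"
  by (induction n) (simp_all add: pvar_def mult_single single_add [symmetric])

lemma psubst_pvar_id [simp]: "psubst pvar p = (p :: ('v, 'k::comm_ring_1) mpoly)"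
proof -
  have monom: "(\<Prod>v \<in> A. pvar v ^ f v) = (Poly_Mapping.single (\<Sum>v \<in> A. Poly_Mapping.single v (f v)) 1 :: ('v, 'k) mpoly)"
    if "finite A" for A f
    using that by (induction A) (simp_all add: pvar_power mult_single)
  have sum: "(\<Sum>v \<in> Poly_Mapping.keys t. Poly_Mapping.single v (Poly_Mapping.lookup t v)) = t" for t :: "'v \<Rightarrow>\<^sub>0 nat"
    by (rule poly_mapping_eqI)
      (simp add: lookup_sum lookup_single when_def sum.delta in_keys_iff)
  have "psubst pvar (Poly_Mapping.single t c) = (Poly_Mapping.single t c :: ('v, 'k) mpoly)" for t c
    by (simp add: psubst_eq_peval peval_single monom sum pconst_def mult_single)
  then show ?thesis
    by (induction p rule: mpoly_single_induct) (simp_all add: psubst.hom_add)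
qed

text \<open>Writing \<open>p\<close> as \<open>psubst pvar p\<close> displays it as a sum of
  products of constants and variables from \<open>V\<close>. So two homomorphisms can be compared on
  constants and variables alone.\<close>

lemma mpoly_induct [consumes 1, case_names const var add mult]:
  fixes p :: "('v, 'k::comm_ring_1) mpoly"
  assumes "pvars p \<subseteq> V"
    and const: "\<And>c. P (pconst c)"
    and var: "\<And>v. v \<in> V \<Longrightarrow> P (pvar v)"
    and add: "\<And>p q. P p \<Longrightarrow> P q \<Longrightarrow> P (p + q)"
    and mult: "\<And>p q. P p \<Longrightarrow> P q \<Longrightarrow> P (p * q)"
  shows "P p"
proof -
  have P0: "P 0" and P1: "P 1"
    using const[of 0] const[of 1] by simp_all
  have power: "P (q ^ n)" if "P q" for q n
    using that by (induction n) (simp_all add: P1 mult)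
  have prod: "P (prod f A)" if "finite A" "\<And>x. x \<in> A \<Longrightarrow> P (f x)" for f and A :: "'v set"
    using that by (induction A) (simp_all add: P1 mult)
  have sum: "P (sum f A)" if "finite A" "\<And>x. x \<in> A \<Longrightarrow> P (f x)" for f and A :: "('v \<Rightarrow>\<^sub>0 nat) set"
    using that by (induction A) (simp_all add: P0 add)
  have "P (psubst pvar p)"
    unfolding psubst_def using assms(1)
    by (intro sum mult const prod power var) (auto simp: pvars_def)
  then show ?thesis by simp
qed

lemma peval_cong:
  assumes "\<And>v. v \<in> pvars p \<Longrightarrow> s v = s' v"
  shows "peval h s p = peval h s' p"
  unfolding peval_def
  by (intro sum.cong refl arg_cong2[of _ _ _ _ "(*)"] prod.cong arg_cong2[of _ _ _ _ "(^)"] assms)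
    (auto simp: pvars_def)

text \<open>Both sides are ring homomorphisms in \<open>p\<close> that agree on constants and
  variables. With \<open>g\<close> a specialisation of the matrix entries, this turns a relation
  between minors into one between specialised minors.\<close>

lemma hom_psubst:
  assumes "comm_ring_hom h" and "comm_ring_hom g" and "\<And>c. g (pconst c) = h c"
  shows "g (psubst s p) = peval h (\<lambda>v. g (s v)) p"
proof -
  interpret g: comm_ring_hom g by fact
  interpret e: comm_ring_hom "peval h (\<lambda>v. g (s v))"
    by (rule peval_hom) fact
  have "pvars p \<subseteq> UNIV" by simp
  then show ?thesis
    by (induction p rule: mpoly_induct)
      (simp_all add: assms peval_pconst peval_pvar psubst.hom_add psubst.hom_mult
        g.hom_add g.hom_mult e.hom_add e.hom_mult)
qed

lemma psubst_psubst:
  "psubst s (psubst s' p) = psubst (\<lambda>v. psubst s (s' v)) p"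
  using hom_psubst[OF pconst_hom psubst.comm_ring_hom_axioms, of s s' p]
  by (simp add: psubst_eq_peval[of "\<lambda>v. psubst s (s' v)"])

lemma psubst_cong:
  assumes "\<And>v. v \<in> pvars p \<Longrightarrow> s v = s' v"
  shows "psubst s p = psubst s' p"
  using peval_cong[OF assms] by (simp add: psubst_eq_peval)

section \<open>The variables occurring in a polynomial\<close>

lemma pvars_zero [simp]: "pvars 0 = {}"
  by (simp add: pvars_def)

lemma pvars_pconst [simp]: "pvars (pconst c) = {}"
  by (simp add: pvars_def pconst_def)

lemma pvars_one [simp]: "pvars 1 = {}"
  by (simp add: pvars_def)

lemma pvars_pvar [simp]: "pvars (pvar v :: ('v, 'k::comm_ring_1) mpoly) = {v}"
  by (simp add: pvars_def pvar_def)

lemma pvars_uminus [simp]: "pvars (- p) = pvars p"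
  by (simp add: pvars_def)

lemma pvars_add: "pvars (p + q) \<subseteq> pvars p \<union> pvars q"
  using keys_add[of p q] by (auto simp: pvars_def)

lemma pvars_diff: "pvars (p - q) \<subseteq> pvars p \<union> pvars q"
  using pvars_add[of p "- q"] by simp

lemma pvars_mult: "pvars (p * q) \<subseteq> pvars p \<union> pvars q"
proof
  fix v assume "v \<in> pvars (p * q)"
  then obtain t where "t \<in> Poly_Mapping.keys (p * q)" "v \<in> Poly_Mapping.keys t"
    by (auto simp: pvars_def)
  then show "v \<in> pvars p \<union> pvars q"
    using keys_mult[of p q] keys_add by (fastforce simp: pvars_def)
qed

lemma finite_pvars [simp]: "finite (pvars p)"
  by (simp add: pvars_def)

lemma pvars_psubst:
  assumes "\<And>v. v \<in> pvars p \<Longrightarrow> pvars (s v) \<subseteq> V"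
  shows "pvars (psubst s p) \<subseteq> V"
  using order_refl[of "pvars p"]
proof (induction p rule: mpoly_induct)
  case (add p q)
  then show ?case using pvars_add[of "psubst s p" "psubst s q"] by (auto simp: psubst.hom_add)
next
  case (mult p q)
  then show ?case using pvars_mult[of "psubst s p" "psubst s q"] by (auto simp: psubst.hom_mult)
qed (use assms in auto)

section \<open>Polynomial rings as rings with carrier\<close>

lemma poly_ring_simps [simp]:
  "carrier (poly_ring V) = {p. pvars p \<subseteq> V}"
  "mult (poly_ring V) = (*)" "one (poly_ring V) = 1"
  "zero (poly_ring V) = 0" "add (poly_ring V) = (+)"
  by (simp_all add: poly_ring_def)

lemma ring_poly_ring: "ring (poly_ring V :: ('v, 'k::comm_ring_1) mpoly ring)"
proof (rule ringI)
  show "abelian_group (poly_ring V :: ('v, 'k) mpoly ring)"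
  proof (rule abelian_groupI)
    fix x :: "('v, 'k) mpoly" assume "x \<in> carrier (poly_ring V)"
    then show "\<exists>y\<in>carrier (poly_ring V). y \<oplus>\<^bsub>poly_ring V\<^esub> x = \<zero>\<^bsub>poly_ring V\<^esub>"
      by (intro bexI[of _ "- x"]) simp_all
  qed (use pvars_add in \<open>fastforce simp: algebra_simps\<close>)+
  show "Group.monoid (poly_ring V :: ('v, 'k) mpoly ring)"
    by (rule monoidI) (use pvars_mult in \<open>fastforce simp: algebra_simps\<close>)+
qed (auto simp: algebra_simps)

lemma a_inv_poly_ring:
  assumes "p \<in> carrier (poly_ring V)"
  shows "\<ominus>\<^bsub>poly_ring V\<^esub> p = - p"
proof -
  interpret ring "poly_ring V" by (rule ring_poly_ring)
  show ?thesis
    using assms by (intro minus_equality) simp_all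
qed

section \<open>Determinants\<close>

lemma det_multcol:
  fixes M :: "'a::comm_ring_1 mat"
  assumes "k < n" and M: "M \<in> carrier_mat n n"
  shows "Determinant.det (mat n n (\<lambda>(r, c). if c = k then a * M $$ (r, c) else M $$ (r, c))) =
    a * Determinant.det M"
proof -
  have "mat n n (\<lambda>(r, c). if c = k then a * M $$ (r, c) else M $$ (r, c)) =
      transpose_mat (multrow k a (transpose_mat M))"
    using M by (intro eq_matI) auto
  then show ?thesis
    using assms by (simp add: det_transpose[of _ n] det_multrow[of k n])
qed

lemma det_zero_row:
  fixes M :: "'a::comm_ring_1 mat"
  assumes "k < n" and M: "M \<in> carrier_mat n n" and "\<And>c. c < n \<Longrightarrow> M $$ (k, c) = 0"
  shows "Determinant.det M = 0"
proof -
  \<comment> \<open>Scaling a zero row by 0 changes nothing, so the determinant is 0 times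
    itself.\<close>
  have "M = multrow k 0 M"
    using assms by (intro eq_matI) auto
  then show ?thesis
    using det_multrow[OF assms(1) M, of 0] by simp
qed

lemma det_zero_col:
  fixes M :: "'a::comm_ring_1 mat"
  assumes "k < n" and M: "M \<in> carrier_mat n n" and "\<And>r. r < n \<Longrightarrow> M $$ (r, k) = 0"
  shows "Determinant.det M = 0"
  using det_zero_row[of k n "transpose_mat M"] assms by (simp add: det_transpose)

text \<open>Multiplying on the right by the block triangular matrix with rows (A', -A'B) and (0, 1)
  clears the upper right block and leaves a block lower triangular matrix with diagonal blocks 1 and
  D - CA'B. Taking determinants and using det A * det A' = 1 gives the claim.\<close>

lemma det_schur_complement:
  fixes A :: "'a::idom mat"
  assumes A: "A \<in> carrier_mat p p" and B: "B \<in> carrier_mat p m"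
    and C: "C \<in> carrier_mat m p" and D: "D \<in> carrier_mat m m"
    and A': "A' \<in> carrier_mat p p" and inv: "A * A' = 1\<^sub>m p"
  shows "Determinant.det (four_block_mat A B C D) =
    Determinant.det A * Determinant.det (D - C * A' * B)"
proof -
  let ?E = "D - C * A' * B"
  have carr [simp]: "A' * B \<in> carrier_mat p m" "C * A' \<in> carrier_mat m p" "?E \<in> carrier_mat m m"
    using A' B C D by auto
  have "four_block_mat A B C D * four_block_mat A' (- (A' * B)) (0\<^sub>m m p) (1\<^sub>m m) =
      four_block_mat (A * A' + B * 0\<^sub>m m p) (A * - (A' * B) + B * 1\<^sub>m m)
        (C * A' + D * 0\<^sub>m m p) (C * - (A' * B) + D * 1\<^sub>m m)"
    using A B C D A' by (intro mult_four_block_mat) auto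
  also have "A * A' + B * 0\<^sub>m m p = 1\<^sub>m p"
    using inv B by simp
  also have "A * - (A' * B) + B * 1\<^sub>m m = 0\<^sub>m p m"
  proof -
    have "A * - (A' * B) = - (A * (A' * B))"
      using A A' B by simp
    also have "A * (A' * B) = B"
      using A A' B inv by (simp flip: assoc_mult_mat)
    finally show ?thesis
      using B by (simp add: uminus_l_inv_mat)
  qed
  also have "C * A' + D * 0\<^sub>m m p = C * A'"
    using D by simp
  also have "C * - (A' * B) + D * 1\<^sub>m m = ?E"
  proof -
    have "C * - (A' * B) = - (C * (A' * B))"
      using C A' B by simp
    also have "C * (A' * B) = C * A' * B"
      using C A' B by (simp flip: assoc_mult_mat)
    finally show ?thesis
      using B C D A' by (intro eq_matI) auto
  qed
  finally have prod: "four_block_mat A B C D * four_block_mat A' (- (A' * B)) (0\<^sub>m m p) (1\<^sub>m m) =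
      four_block_mat (1\<^sub>m p) (0\<^sub>m p m) (C * A') ?E" .
  have "Determinant.det (four_block_mat A B C D) *
      Determinant.det (four_block_mat A' (- (A' * B)) (0\<^sub>m m p) (1\<^sub>m m)) =
      Determinant.det (four_block_mat (1\<^sub>m p) (0\<^sub>m p m) (C * A') ?E)"
    unfolding prod[symmetric] using A A' D
    by (intro det_mult[symmetric, of _ "p + m"]) auto
  also have "Determinant.det (four_block_mat A' (- (A' * B)) (0\<^sub>m m p) (1\<^sub>m m)) = Determinant.det A'"
    by (subst det_four_block_mat_lower_left_zero[of _ p _ m]) (use A' in auto)
  also have "Determinant.det (four_block_mat (1\<^sub>m p) (0\<^sub>m p m) (C * A') ?E) = Determinant.det ?E"
    by (subst det_four_block_mat_upper_right_zero[of _ p _ m]) auto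
  finally have "Determinant.det (four_block_mat A B C D) * Determinant.det A' = Determinant.det ?E" .
  moreover have "Determinant.det A * Determinant.det A' = 1"
    using det_mult[OF A A'] inv by simp
  ultimately show ?thesis
    by (metis mult.assoc mult.commute mult.right_neutral)
qed

lemma obtain_inverse_mat:
  fixes A :: "'a::field mat"
  assumes A: "A \<in> carrier_mat p p" and "Determinant.det A \<noteq> 0"
  obtains A' where "A' \<in> carrier_mat p p" "A * A' = 1\<^sub>m p"
proof
  show "inverse (Determinant.det A) \<cdot>\<^sub>m adj_mat A \<in> carrier_mat p p"
    using adj_mat(1)[OF A] by simp
  show "A * (inverse (Determinant.det A) \<cdot>\<^sub>m adj_mat A) = 1\<^sub>m p"
    using adj_mat[OF A] A assms(2)
    by (intro eq_matI) (auto simp: mult_smult_distrib[of _ p p _ p])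
qed

section \<open>Relations between maximal minors\<close>

lemma hom_minor:
  assumes "comm_ring_hom g"
  shows "g (minor m ls) = Determinant.det (mat m m (\<lambda>(r, c). g (pvar (ls ! r, int c - int m))))"
proof -
  interpret g: comm_ring_hom g by fact
  have "map_mat g (mat m m (\<lambda>(r, c). pvar (ls ! r, int c - int m))) =
      mat m m (\<lambda>(r, c). g (pvar (ls ! r, int c - int m)))"
    by (intro eq_matI) auto
  then show ?thesis
    by (simp add: minor_def flip: g.hom_det)
qed

lemma length_pad: "m \<le> m' \<Longrightarrow> length ls = m \<Longrightarrow> length (pad m' m ls) = m'"
  by (simp add: pad_def)

lemma pad_nth:
  assumes "m \<le> m'" "r < m'"
  shows "pad m' m ls ! r = (if r < m' - m then int r - int m' else ls ! (r - (m' - m)))"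
proof -
  have "length [- int m'..- int m - 1] = m' - m"
    using assms(1) by simp
  then show ?thesis
    using assms by (simp add: pad_def nth_append)
qed

text \<open>In the row order of \<open>pad\<close> the specialised matrix is block diagonal: an
  identity block of size m' - m, followed by the generic matrix whose determinant is
  \<open>minor m ls\<close>.\<close>

lemma psubst_minor_pad:
  fixes ls :: "int list"
  assumes "m \<le> m'" and ls: "length ls = m" "set ls \<subseteq> {- int m..int n - 1}"
  shows "psubst (\<lambda>(i, j). if i < - int m \<or> j < - int m then if i = j then 1 else 0
      else if i < int n then pvar (i, j) else 0) (minor m' (pad m' m ls)) =
    (minor m ls :: (int \<times> int, 'k::idom) mpoly)"
    (is "psubst ?s _ = _")
proof -
  define p where "p = m' - m"
  have m': "m' = p + m" using assms(1) by (simp add: p_def)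
  let ?D = "mat m m (\<lambda>(r, c). pvar (ls ! r, int c - int m)) :: (int \<times> int, 'k) mpoly mat"
  have in_ls: "- int m \<le> ls ! r" "ls ! r < int n" if "r < m" for r
    using ls nth_mem[of r ls] that by force+
  have nth: "pad m' m ls ! r = (if r < p then int r - int m' else ls ! (r - p))" if "r < m'" for r
    using pad_nth[OF assms(1) that] by (simp add: p_def)
  have "mat m' m' (\<lambda>(r, c). psubst ?s (pvar (pad m' m ls ! r, int c - int m'))) =
      four_block_mat (1\<^sub>m p) (0\<^sub>m p m) (0\<^sub>m m p) ?D" (is "?L = ?R")
  proof (rule eq_matI)
    fix r c assume "r < dim_row ?R" "c < dim_col ?R"
    then have rc: "r < m'" "c < m'" by (simp_all add: m')
    have L: "?L $$ (r, c) = psubst ?s (pvar (if r < p then int r - int m' else ls ! (r - p), int c - int m'))"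
      using rc nth by simp
    show "?L $$ (r, c) = ?R $$ (r, c)"
    proof (cases "r < p")
      case True
      then show ?thesis
        unfolding L using rc m' by auto
    next
      case False
      then have "- int m \<le> ls ! (r - p)" "ls ! (r - p) < int n"
        using rc m' by (auto intro: in_ls)
      then show ?thesis
        unfolding L using rc m' False by (auto simp: of_nat_diff diff_diff_eq)
    qed
  qed (simp_all add: m')
  moreover have "Determinant.det (four_block_mat (1\<^sub>m p) (0\<^sub>m p m) (0\<^sub>m m p) ?D) = minor m ls"
    by (subst det_four_block_mat_lower_left_zero[of _ p _ m]) (auto simp: minor_def)
  ultimately show ?thesis
    by (simp add: hom_minor[OF psubst.comm_ring_hom_axioms])
qed

text \<open>A row list fails to be padded for one of two reasons. Either it has an entry >= n, which
  gives a zero row, or it omits some j < -m, and then column j is zero because its only nonzero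
  entry sits in row j.\<close>

lemma psubst_minor_not_pad:
  assumes "m \<le> m'" and ls: "ls \<in> row_lists m' n'" "ls \<notin> pad m' m ` row_lists m n"
  shows "psubst (\<lambda>(i, j). if i < - int m \<or> j < - int m then if i = j then 1 else 0
      else if i < int n then pvar (i, j) else 0) (minor m' ls) =
    (0 :: (int \<times> int, 'k::idom) mpoly)"
    (is "psubst ?s _ = _")
proof -
  have len: "length ls = m'" and sorted: "sorted_wrt (<) ls" and set: "set ls \<subseteq> {- int m'..int n' - 1}"
    using ls by (auto simp: row_lists_def)
  let ?M = "mat m' m' (\<lambda>(r, c). psubst ?s (pvar (ls ! r, int c - int m'))) :: (int \<times> int, 'k) mpoly mat"
  have "Determinant.det ?M = 0"
  proof (cases "\<exists>x \<in> set ls. x \<ge> int n")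
    case True
    then obtain r where r: "r < m'" "ls ! r \<ge> int n"
      by (auto simp: in_set_conv_nth len)
    then show ?thesis
      by (intro det_zero_row[of r m']) auto
  next
    case False
    \<comment> \<open>If all indices below -m occurred, sortedness would put them first, and the
      remaining entries would form a row list of type (m, n).\<close>
    have "\<not> {- int m'..- int m - 1} \<subseteq> set ls"
    proof
      assume sub: "{- int m'..- int m - 1} \<subseteq> set ls"
      let ?l = "filter (\<lambda>x. - int m \<le> x) ls"
      have "sorted_wrt (<) (pad m' m ?l)"
        using sorted by (auto simp: pad_def sorted_wrt_append sorted_wrt_filter)
      moreover have "set (pad m' m ?l) = set ls"
        using sub set by (auto simp: pad_def)
      ultimately have eq: "pad m' m ?l = ls"
        using sorted by (intro strict_sorted_equal) auto
      have "length ?l = m"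
        using arg_cong[OF eq, of length] len assms(1) by (simp add: pad_def)
      then have "?l \<in> row_lists m n"
        using sorted set False by (auto simp: row_lists_def sorted_wrt_filter)
      then show False
        using ls(2) eq by (metis imageI)
    qed
    then obtain j where j: "- int m' \<le> j" "j < - int m" "j \<notin> set ls"
      by (auto simp: subset_iff)
    have "ls ! r \<noteq> j" if "r < m'" for r
      using that j(3) len by auto
    then show ?thesis
      \<comment> \<open>Column c of the matrix carries the index c - m', so the index j sits in
        column j + m'.\<close>
      using j by (intro det_zero_col[of "nat (j + int m')" m']) auto
  qed
  then show ?thesis
    by (simp add: hom_minor[OF psubst.comm_ring_hom_axioms])
qed

text \<open>Over the fraction field, Schur complement turns the padded minors into \<open>det A\<close> times the
  minors of another matrix. The factor \<open>det A\<close> is absorbed by rescaling one column, which is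
  possible because \<open>m > 0\<close>; so homogeneity of the relation plays no role.\<close>

lemma minor_relation_pad:
  fixes F :: "('x, 'k::idom) mpoly"
  assumes "0 < m" "m \<le> m'" and ls: "\<And>x. x \<in> pvars F \<Longrightarrow> length (ls x) = m"
    and F: "psubst (\<lambda>x. minor m (ls x)) F = 0"
  shows "psubst (\<lambda>x. minor m' (pad m' m (ls x))) F = 0"
proof -
  define p where "p = m' - m"
  have m': "m' = p + m" using assms(2) by (simp add: p_def)
  define h where "h = (\<lambda>c. to_fract (pconst c :: (int \<times> int, 'k) mpoly))"
  have to_fract: "comm_ring_hom (to_fract :: (int \<times> int, 'k) mpoly \<Rightarrow> _)"
    by unfold_locales simp_all
  have h: "comm_ring_hom h"
    unfolding h_def by unfold_locales (simp_all add: pconst.hom_add pconst.hom_mult)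
  define x where "x = (\<lambda>i j. to_fract (pvar (i, j) :: (int \<times> int, 'k) mpoly))"
  define A where "A = mat p p (\<lambda>(r, c). x (int r - int m') (int c - int m'))"
  define B where "B = mat p m (\<lambda>(r, c). x (int r - int m') (int c - int m))"
  have [simp]: "A \<in> carrier_mat p p" "B \<in> carrier_mat p m"
    by (simp_all add: A_def B_def)
  \<comment> \<open>The generic block specialises to the identity matrix, so its determinant is not
    the zero polynomial.\<close>
  have "Determinant.det A \<noteq> 0"
  proof -
    define A0 where "A0 = (mat p p (\<lambda>(r, c). pvar (int r - int m', int c - int m')) :: (int \<times> int, 'k) mpoly mat)"
    interpret to_fract: comm_ring_hom "to_fract :: (int \<times> int, 'k) mpoly \<Rightarrow> _" by (rule to_fract)
    have "map_mat to_fract A0 = A"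
      by (intro eq_matI) (auto simp: A_def A0_def x_def)
    then have "Determinant.det A = to_fract (Determinant.det A0)"
      by (metis to_fract.hom_det)
    moreover have "map_mat (psubst (\<lambda>(i, j). if i = j then 1 else 0)) A0 =
        (1\<^sub>m p :: (int \<times> int, 'k) mpoly mat)"
      by (intro eq_matI) (auto simp: A0_def)
    then have "psubst (\<lambda>(i, j). if i = j then 1 else 0) (Determinant.det A0) = (1 :: (int \<times> int, 'k) mpoly)"
      by (simp flip: psubst.hom_det)
    then have "Determinant.det A0 \<noteq> 0"
      by auto
    ultimately show ?thesis by simp
  qed
  then obtain A' where A': "A' \<in> carrier_mat p p" "A * A' = 1\<^sub>m p"
    using obtain_inverse_mat[of A p] by auto
  have dimA' [simp]: "dim_row A' = p" "dim_col A' = p" using A' by auto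
  \<comment> \<open>This is an entry of D - CA'B, written for an arbitrary row index
    \<open>i\<close>. It depends on \<open>i\<close> and not on the row list, so a single
    substitution serves all minors in the relation simultaneously.\<close>
  define e where "e = (\<lambda>i j. x i j - (\<Sum>t<p. (\<Sum>s<p. x i (int s - int m') * A' $$ (s, t)) * x (int t - int m') j))"
  \<comment> \<open>The rescaled column \<open>- int m\<close> is the one with c = 0 in every minor
    of size m.\<close>
  define \<sigma> where "\<sigma> = (\<lambda>(i, j). if j = - int m then Determinant.det A * e i j else e i j)"
  have key: "peval h \<sigma> (minor m l) = to_fract (minor m' (pad m' m l))" if l: "length l = m" for l
  proof -
    define C where "C = mat m p (\<lambda>(r, c). x (l ! r) (int c - int m'))"
    define D where "D = mat m m (\<lambda>(r, c). x (l ! r) (int c - int m))"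
    have [simp]: "C \<in> carrier_mat m p" "D \<in> carrier_mat m m"
      by (simp_all add: C_def D_def)
    have E: "D - C * A' * B = mat m m (\<lambda>(r, c). e (l ! r) (int c - int m))"
      by (intro eq_matI)
        (auto simp: e_def A_def B_def C_def D_def scalar_prod_def atLeast0LessThan)
    have "peval h \<sigma> (minor m l) = Determinant.det (mat m m (\<lambda>(r, c). \<sigma> (l ! r, int c - int m)))"
      by (simp add: hom_minor[OF peval_hom[OF h]] peval_pvar[OF h])
    also have "mat m m (\<lambda>(r, c). \<sigma> (l ! r, int c - int m)) =
        mat m m (\<lambda>(r, c). if c = 0 then Determinant.det A * (D - C * A' * B) $$ (r, c)
          else (D - C * A' * B) $$ (r, c))"
      unfolding E by (intro eq_matI) (auto simp: \<sigma>_def)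
    also have "Determinant.det \<dots> = Determinant.det A * Determinant.det (D - C * A' * B)"
      using \<open>0 < m\<close> by (intro det_multcol) (auto simp: E)
    also have "\<dots> = Determinant.det (four_block_mat A B C D)"
      by (rule det_schur_complement[symmetric, of _ p _ m]) (use A' in simp_all)
    also have "four_block_mat A B C D =
        mat m' m' (\<lambda>(r, c). to_fract (pvar (pad m' m l ! r, int c - int m')))" (is "?L = ?R")
    proof (rule eq_matI)
      fix r c assume "r < dim_row ?R" "c < dim_col ?R"
      then have "r < m'" "c < m'" by simp_all
      then show "?L $$ (r, c) = ?R $$ (r, c)"
        using pad_nth[OF assms(2) \<open>r < m'\<close>, of l]
        by (auto simp: A_def B_def C_def D_def x_def m' of_nat_diff diff_diff_eq)
    qed (simp_all add: A_def D_def m')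
    also have "Determinant.det \<dots> = to_fract (minor m' (pad m' m l))"
      by (rule hom_minor[OF to_fract, symmetric])
    finally show ?thesis .
  qed
  have "to_fract (psubst (\<lambda>x. minor m' (pad m' m (ls x))) F) =
      peval h (\<lambda>x. to_fract (minor m' (pad m' m (ls x)))) F"
    by (rule hom_psubst[OF h to_fract]) (simp add: h_def)
  also have "\<dots> = peval h (\<lambda>x. peval h \<sigma> (minor m (ls x))) F"
    by (rule peval_cong) (simp add: key ls)
  also have "\<dots> = peval h \<sigma> (psubst (\<lambda>x. minor m (ls x)) F)"
    by (rule hom_psubst[OF h peval_hom[OF h] peval_pconst[OF h], symmetric])
  also have "\<dots> = 0"
    unfolding F by (simp add: peval_def)
  finally show ?thesis by simp
qed

section \<open>Maya diagrams and row sets\<close>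

lemma maya_seq_strict_mono: "strict_mono (maya_seq a)"
  using maya_seq[of a] by simp

lemma maya_type_mono:
  assumes "m \<le> m'" "n \<le> n'"
  shows "maya_type m n \<subseteq> maya_type m' n'"
  using assms by (auto simp: maya_type_def)

lemma length_maya_rows [simp]: "length (maya_rows m a) = m"
  by (simp add: maya_rows_def)

lemma maya_rows_nth: "r < m \<Longrightarrow> maya_rows m a ! r = - maya_seq a (m - 1 - r)"
  by (simp add: maya_rows_def)

lemma maya_rows_in_row_lists:
  assumes "a \<in> maya_type m n"
  shows "maya_rows m a \<in> row_lists m n"
proof -
  \<comment> \<open>Counting from zero, the term at position m is m + 1, so the earlier terms are at
    most m.\<close>
  have "maya_seq a j < int m + 1" if "j < m" for j
    using strict_monoD[OF maya_seq_strict_mono that, of a] assms by (simp add: maya_type_def)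
  moreover have "1 - int n \<le> maya_seq a j" for j
    using monoD[OF strict_mono_mono[OF maya_seq_strict_mono], of 0 j a] assms
    by (simp add: maya_type_def)
  ultimately have "maya_rows m a ! r \<in> {- int m..int n - 1}" if "r < m" for r
    using that by (simp add: maya_rows_nth) (smt (verit) diff_Suc_less diff_less_mono2 less_imp_diff_less)
  then have "set (maya_rows m a) \<subseteq> {- int m..int n - 1}"
    by (metis in_set_conv_nth length_maya_rows subsetI)
  moreover have "sorted_wrt (<) (maya_rows m a)"
    by (auto simp: sorted_wrt_iff_nth_less maya_rows_nth intro!: strict_monoD[OF maya_seq_strict_mono])
  ultimately show ?thesis
    by (simp add: row_lists_def)
qed

lemma row_lists_eq_maya_rows:
  assumes "0 < m" and ls: "ls \<in> row_lists m n"
  obtains a where "a \<in> maya_type m n" "maya_rows m a = ls"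
proof -
  have len: "length ls = m" and sorted: "sorted_wrt (<) ls" and set: "set ls \<subseteq> {- int m..int n - 1}"
    using ls by (auto simp: row_lists_def)
  have bounds: "- int m \<le> ls ! r" "ls ! r < int n" if "r < m" for r
    using set nth_mem[of r ls] that len by force+
  define f where "f = (\<lambda>i. if i < m then - (ls ! (m - 1 - i)) else int i + 1)"
  \<comment> \<open>At the seam i = m - 1 the bound -m <= \<open>ls ! 0\<close> gives f (m - 1) <= m
    < m + 1 = f m.\<close>
  have "f i < f (Suc i)" for i
    using bounds[of 0] \<open>0 < m\<close> sorted len
    by (auto simp: f_def sorted_wrt_iff_nth_less not_less less_Suc_eq)
  then have "strict_mono f"
    by (simp add: strict_mono_Suc_iff)
  then have f: "maya_seq (Abs_maya f) = f"
    by (intro Abs_maya_inverse) (auto simp: f_def intro!: exI[of _ m])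
  show thesis
  proof
    show "Abs_maya f \<in> maya_type m n"
      using bounds[of "m - 1"] \<open>0 < m\<close> unfolding maya_type_def mem_Collect_eq f by (simp add: f_def)
    show "maya_rows m (Abs_maya f) = ls"
      by (intro nth_equalityI) (simp_all add: maya_rows_nth len f, simp add: f_def)
  qed
qed

lemma maya_rows_inj:
  assumes "a \<in> maya_type m n" "b \<in> maya_type m n'" and eq: "maya_rows m a = maya_rows m b"
  shows "a = b"
proof -
  have "maya_seq a i = maya_seq b i" for i
  proof (cases "i < m")
    case True
    then show ?thesis
      using arg_cong[OF eq, of "\<lambda>l. l ! (m - 1 - i)"] by (simp add: maya_rows_nth)
  qed (use assms in \<open>simp add: maya_type_def\<close>)
  then show ?thesis
    by (metis ext maya_seq_inject)
qed

text \<open>For m < i <= m' the terms a_i = i, negated and reversed, are exactly the padding. Hence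
  the padded list belongs to the same diagram, and raising the type leaves the variable of S
  unchanged.\<close>

lemma maya_rows_pad:
  assumes "m \<le> m'" "a \<in> maya_type m n"
  shows "maya_rows m' a = pad m' m (maya_rows m a)"
proof (intro nth_equalityI)
  fix r assume "r < length (maya_rows m' a)"
  then have r: "r < m'" by simp
  show "maya_rows m' a ! r = pad m' m (maya_rows m a) ! r"
  proof (cases "r < m' - m")
    case True
    then have "maya_seq a (m' - 1 - r) = int (m' - 1 - r) + 1"
      using assms by (simp add: maya_type_def)
    then show ?thesis
      using r True assms by (simp add: maya_rows_nth pad_nth of_nat_diff)
  next
    case False
    then have "m - 1 - (r - (m' - m)) = m' - 1 - r" "r - (m' - m) < m"
      using r assms by linarith+
    then show ?thesis
      using r False assms by (simp add: maya_rows_nth pad_nth)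
  qed
qed (simp add: length_pad assms)

section \<open>The algebras of maximal minors\<close>

lemma carrier_S_ring: "carrier (S_ring m n) = {p. pvars p \<subseteq> maya_type m n}"
  by (simp add: S_ring_def)

lemma ring_S_ring: "ring (S_ring m n :: (maya, 'k::comm_ring_1) mpoly ring)"
  unfolding S_ring_def by (rule ring_poly_ring)

lemma S_ring_simps [simp]:
  "mult (S_ring m n) = (*)" "one (S_ring m n) = 1" "zero (S_ring m n) = 0" "add (S_ring m n) = (+)"
  by (simp_all add: S_ring_def)

lemma S_ring_closed:
  "pconst c \<in> carrier (S_ring m n)"
  "p \<in> carrier (S_ring m n) \<Longrightarrow> q \<in> carrier (S_ring m n) \<Longrightarrow> p + q \<in> carrier (S_ring m n)"
  "p \<in> carrier (S_ring m n) \<Longrightarrow> q \<in> carrier (S_ring m n) \<Longrightarrow> p - q \<in> carrier (S_ring m n)"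
  "p \<in> carrier (S_ring m n) \<Longrightarrow> q \<in> carrier (S_ring m n) \<Longrightarrow> p * q \<in> carrier (S_ring m n)"
  "p \<in> carrier (S_ring m n) \<Longrightarrow> - p \<in> carrier (S_ring m n)"
  using pvars_add[of p q] pvars_diff[of p q] pvars_mult[of p q] by (auto simp: carrier_S_ring)

lemma S_ring_mono:
  "m \<le> m' \<Longrightarrow> n \<le> n' \<Longrightarrow> carrier (S_ring m n) \<subseteq> carrier (S_ring m' n')"
  using maya_type_mono[of m m' n n'] by (auto simp: carrier_S_ring)

interpretation S_to_minor: comm_ring_hom "S_to_minor m :: (maya, 'k::comm_ring_1) mpoly \<Rightarrow> _"
  unfolding S_to_minor_def by (rule psubst.comm_ring_hom_axioms)

interpretation S_proj: comm_ring_hom "S_proj m n :: (maya, 'k::comm_ring_1) mpoly \<Rightarrow> _"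
  unfolding S_proj_def by (rule psubst.comm_ring_hom_axioms)

lemma S_to_minor_pconst [simp]: "S_to_minor m (pconst c) = pconst c"
  by (simp add: S_to_minor_def)

lemma S_to_minor_pvar [simp]: "S_to_minor m (pvar a) = d_maya m a"
  by (simp add: S_to_minor_def)

lemma S_proj_pconst [simp]: "S_proj m n (pconst c) = pconst c"
  by (simp add: S_proj_def)

lemma S_proj_pvar [simp]: "S_proj m n (pvar a) = (if a \<in> maya_type m n then pvar a else 0)"
  by (simp add: S_proj_def)

lemma S_proj_closed: "S_proj m n p \<in> carrier (S_ring m n)"
  unfolding S_proj_def carrier_S_ring mem_Collect_eq by (rule pvars_psubst) simp

lemma S_proj_id:
  assumes "p \<in> carrier (S_ring m n)"
  shows "S_proj m n p = p"
proof -
  have "S_proj m n p = psubst pvar p"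
    unfolding S_proj_def using assms by (intro psubst_cong) (auto simp: carrier_S_ring)
  then show ?thesis by simp
qed

lemma S_proj_S_proj:
  assumes "m \<le> m'" "n \<le> n'"
  shows "S_proj m n (S_proj m' n' p) = S_proj m n p"
proof -
  show ?thesis
    unfolding S_proj_def psubst_psubst
    by (intro psubst_cong) (use maya_type_mono[OF assms] in auto)
qed

lemma minor_alg_simps [simp]:
  "mult (minor_alg m n) = (*)" "one (minor_alg m n) = 1" "zero (minor_alg m n) = 0"
  "add (minor_alg m n) = (+)"
  by (simp_all add: minor_alg_def entry_ring_def)

lemma minor_alg_generators_closed:
  assumes "0 < m"
  shows "range pconst \<union> minor m ` row_lists m n \<subseteq>
    carrier (entry_ring m n :: (int \<times> int, 'k::idom) mpoly ring)"
proof -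
  have "pvars (minor m ls :: (int \<times> int, 'k) mpoly) \<subseteq> {- int m..int n - 1} \<times> {- int m..int n - 1}"
    if ls: "ls \<in> row_lists m n" for ls
  proof -
    let ?V = "{- int m..int n - 1} \<times> {- int m..int n - 1}"
    have len: "length ls = m" and set: "set ls \<subseteq> {- int m..int n - 1}"
      using ls by (auto simp: row_lists_def)
    \<comment> \<open>Instead of tracking variables through the determinant, kill all variables
      outside \<open>?V\<close>: the minor is fixed, while any result of this substitution has its
      variables in \<open>?V\<close>.\<close>
    let ?s = "\<lambda>v. if v \<in> ?V then pvar v else (0 :: (int \<times> int, 'k) mpoly)"
    have "(ls ! r, int c - int m) \<in> ?V" if "r < m" "c < m" for r c
    proof -
      have "ls ! r \<in> {- int m..int n - 1}"
        using set that len by (metis nth_mem subsetD)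
      then show ?thesis
        using that by simp
    qed
    then have "mat m m (\<lambda>(r, c). psubst ?s (pvar (ls ! r, int c - int m))) =
        mat m m (\<lambda>(r, c). pvar (ls ! r, int c - int m))"
      by (intro eq_matI) (auto simp del: mem_Sigma_iff)
    then have "psubst ?s (minor m ls) = minor m ls"
      by (simp add: hom_minor[OF psubst.comm_ring_hom_axioms]) (simp add: minor_def)
    moreover have "pvars (psubst ?s (minor m ls)) \<subseteq> ?V"
      by (intro pvars_psubst) auto
    ultimately show ?thesis by simp
  qed
  then show ?thesis
    by (auto simp: entry_ring_def)
qed

lemma ring_minor_alg:
  assumes "0 < m"
  shows "ring (minor_alg m n :: (int \<times> int, 'k::idom) mpoly ring)"
  unfolding minor_alg_def
  by (intro ring.generate_ring_is_ring minor_alg_generators_closed assms)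
    (simp add: entry_ring_def ring_poly_ring)

text \<open>Generators correspond through the bijection between diagrams and row lists. From here
  on, elements of the minor algebra are handled through polynomial lifts in
  \<open>S_ring m n\<close>.\<close>

lemma S_to_minor_image:
  assumes "0 < m"
  shows "S_to_minor m ` carrier (S_ring m n) =
    carrier (minor_alg m n :: (int \<times> int, 'k::idom) mpoly ring)"
proof
  interpret R: ring "minor_alg m n :: (int \<times> int, 'k::idom) mpoly ring"
    by (rule ring_minor_alg) fact
  let ?G = "range pconst \<union> minor m ` row_lists m n :: (int \<times> int, 'k) mpoly set"
  have carrier: "carrier (minor_alg m n) = generate_ring (entry_ring m n) ?G"
    by (simp add: minor_alg_def)
  have "S_to_minor m p \<in> carrier (minor_alg m n)" if "pvars p \<subseteq> maya_type m n" for p :: "(maya, 'k) mpoly"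
    using that
  proof (induction p rule: mpoly_induct)
    case (const c)
    show ?case
      by (auto simp: carrier intro!: generate_ring.incl)
  next
    case (var a)
    then show ?case
      by (auto simp: carrier d_maya_def intro!: generate_ring.incl maya_rows_in_row_lists)
  next
    case (add p q)
    then show ?case
      using R.a_closed by (simp add: S_to_minor.hom_add)
  next
    case (mult p q)
    then show ?case
      using R.m_closed by (simp add: S_to_minor.hom_mult)
  qed
  then show "S_to_minor m ` carrier (S_ring m n) \<subseteq> carrier (minor_alg m n :: (int \<times> int, 'k) mpoly ring)"
    by (auto simp: carrier_S_ring)
  show "carrier (minor_alg m n) \<subseteq> S_to_minor m ` (carrier (S_ring m n) :: (maya, 'k) mpoly set)"
  proof
    fix y :: "(int \<times> int, 'k) mpoly"
    assume "y \<in> carrier (minor_alg m n)"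
    then have "y \<in> generate_ring (entry_ring m n) ?G"
      by (simp add: carrier)
    then show "y \<in> S_to_minor m ` carrier (S_ring m n)"
    proof (induction y rule: generate_ring.induct)
      case one
      show ?case
        using S_ring_closed(1)[of 1] by (intro image_eqI[of _ _ 1]) (auto simp: entry_ring_def)
    next
      case (incl y)
      then consider c where "y = pconst c" | ls where "ls \<in> row_lists m n" "y = minor m ls"
        by auto
      then show ?case
      proof cases
        case (1 c)
        then show ?thesis
          by (intro image_eqI[of _ _ "pconst c"]) (auto simp: S_ring_closed)
      next
        case (2 ls)
        then obtain a where "a \<in> maya_type m n" "maya_rows m a = ls"
          using row_lists_eq_maya_rows[OF assms] by blast
        with 2 show ?thesis
          by (intro image_eqI[of _ _ "pvar a"]) (auto simp: carrier_S_ring d_maya_def)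
      qed
    next
      case (a_inv y)
      then have "y \<in> carrier (entry_ring m n)"
        using ring.generate_ring_in_carrier[OF _ minor_alg_generators_closed[OF assms]] a_inv.hyps
        by (simp add: entry_ring_def ring_poly_ring)
      then have "\<ominus>\<^bsub>entry_ring m n\<^esub> y = - y"
        unfolding entry_ring_def by (rule a_inv_poly_ring)
      moreover obtain p where "p \<in> carrier (S_ring m n)" "y = S_to_minor m p"
        using a_inv.IH by blast
      ultimately show ?case
        by (intro image_eqI[of _ _ "- p"]) (auto simp: S_ring_closed S_to_minor.hom_uminus)
    next
      case (eng_add y z)
      then obtain p q where "p \<in> carrier (S_ring m n)" "y = S_to_minor m p"
        "q \<in> carrier (S_ring m n)" "z = S_to_minor m q"
        by blast
      then show ?case
        by (intro image_eqI[of _ _ "p + q"]) (auto simp: entry_ring_def S_ring_closed S_to_minor.hom_add)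
    next
      case (eng_mult y z)
      then obtain p q where "p \<in> carrier (S_ring m n)" "y = S_to_minor m p"
        "q \<in> carrier (S_ring m n)" "z = S_to_minor m q"
        by blast
      then show ?case
        by (intro image_eqI[of _ _ "p * q"]) (auto simp: entry_ring_def S_ring_closed S_to_minor.hom_mult)
    qed
  qed
qed

section \<open>The transition maps\<close>

text \<open>Fact (R) for diagrams. By \<open>maya_rows_pad\<close>, evaluating at the padded minors
  is evaluating the same polynomial one level up.\<close>

lemma S_to_minor_upward:
  fixes p :: "(maya, 'k::idom) mpoly"
  assumes "0 < m" "m \<le> m'" and p: "p \<in> carrier (S_ring m n)" "S_to_minor m p = 0"
  shows "S_to_minor m' p = 0"
proof -
  have "psubst (\<lambda>a. minor m (maya_rows m a)) p = 0"
    using p(2) by (simp add: S_to_minor_def d_maya_def[abs_def])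
  then have "psubst (\<lambda>a. minor m' (pad m' m (maya_rows m a))) p = 0"
    by (intro minor_relation_pad[of m] assms) auto
  also have "psubst (\<lambda>a. minor m' (pad m' m (maya_rows m a))) p = S_to_minor m' p"
    unfolding S_to_minor_def using p(1)
    by (intro psubst_cong) (auto simp: carrier_S_ring d_maya_def maya_rows_pad[OF assms(2)])
  finally show ?thesis .
qed

text \<open>Matches the two descriptions of the surviving generators: padded row lists in
  \<open>e_map\<close>, and diagrams of type (m, n) in \<open>S_proj\<close>.\<close>

lemma maya_rows_in_pad_image_iff:
  assumes "0 < m" "m \<le> m'" "n \<le> n'" and a: "a \<in> maya_type m' n'"
  shows "maya_rows m' a \<in> pad m' m ` row_lists m n \<longleftrightarrow> a \<in> maya_type m n"
proof
  assume "maya_rows m' a \<in> pad m' m ` row_lists m n"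
  then obtain b where b: "b \<in> maya_type m n" "maya_rows m' a = pad m' m (maya_rows m b)"
    using row_lists_eq_maya_rows[OF assms(1)] by blast
  then have "a = b"
    using maya_type_mono[OF assms(2,3)] by (intro maya_rows_inj[OF a]) (auto simp: maya_rows_pad[OF assms(2)])
  with b show "a \<in> maya_type m n" by simp
qed (auto simp: maya_rows_pad[OF assms(2)] maya_rows_in_row_lists)

text \<open>Fact (E). Projecting and then evaluating agrees on every variable with evaluating at
  level m' and then specialising by \<open>?s\<close>, so a relation is sent to 0.\<close>

lemma S_to_minor_S_proj:
  fixes p :: "(maya, 'k::idom) mpoly"
  assumes "0 < m" "m \<le> m'" "n \<le> n'" and p: "p \<in> carrier (S_ring m' n')" "S_to_minor m' p = 0"
  shows "S_to_minor m (S_proj m n p) = 0"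
proof -
  let ?s = "\<lambda>(i, j). if i < - int m \<or> j < - int m then if i = j then 1 else 0
      else if i < int n then pvar (i, j) else (0 :: (int \<times> int, 'k) mpoly)"
  have "psubst ?s (d_maya m' a) = psubst (d_maya m) (if a \<in> maya_type m n then pvar a else 0)"
    if a: "a \<in> maya_type m' n'" for a
  proof (cases "a \<in> maya_type m n")
    case True
    have "set (maya_rows m a) \<subseteq> {- int m..int n - 1}"
      using maya_rows_in_row_lists[OF True] by (simp add: row_lists_def)
    then show ?thesis
      using True psubst_minor_pad[OF assms(2) length_maya_rows]
      by (simp add: d_maya_def maya_rows_pad[OF assms(2) True])
  next
    case False
    then show ?thesis
      using psubst_minor_not_pad[OF assms(2) maya_rows_in_row_lists[OF a]]
        maya_rows_in_pad_image_iff[OF assms(1-3) a]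
      by (simp add: d_maya_def)
  qed
  then have "S_to_minor m (S_proj m n p) = psubst ?s (S_to_minor m' p)"
    unfolding S_to_minor_def S_proj_def psubst_psubst using p(1)
    by (intro psubst_cong) (auto simp: carrier_S_ring)
  then show ?thesis
    using p(2) by (simp add: psubst.hom_zero)
qed

text \<open>The uniqueness half of the definite descriptions \<open>e_map\<close> and
  \<open>r_map\<close>. Off the carrier the maps agree by extensionality.\<close>

lemma minor_alg_hom_eqI:
  fixes B :: "('w, 'k::idom) mpoly ring"
  assumes "0 < m" and f: "f \<in> poly_alg_hom (minor_alg m n) B" and g: "g \<in> poly_alg_hom (minor_alg m n) B"
    and eq: "\<And>ls. ls \<in> row_lists m n \<Longrightarrow> f (minor m ls) = g (minor m ls)"
  shows "f = g"
proof (rule extensionalityI)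
  interpret R: ring "minor_alg m n :: (int \<times> int, 'k) mpoly ring"
    by (rule ring_minor_alg) fact
  show "f \<in> extensional (carrier (minor_alg m n))" "g \<in> extensional (carrier (minor_alg m n))"
    using f g by (auto simp: poly_alg_hom_def)
  have f': "f \<in> Ring.ring_hom (minor_alg m n) B" and g': "g \<in> Ring.ring_hom (minor_alg m n) B"
    using f g by (auto simp: poly_alg_hom_def)
  fix y :: "(int \<times> int, 'k) mpoly"
  assume "y \<in> carrier (minor_alg m n)"
  then obtain p :: "(maya, 'k) mpoly" where "pvars p \<subseteq> maya_type m n" and y: "y = S_to_minor m p"
    unfolding S_to_minor_image[OF assms(1), symmetric] carrier_S_ring by blast
  \<comment> \<open>Membership is carried along because \<open>f\<close> and \<open>g\<close>
    respect the operations only on the carrier.\<close>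
  from this(1) have "S_to_minor m p \<in> carrier (minor_alg m n) \<and> f (S_to_minor m p) = g (S_to_minor m p)"
  proof (induction p rule: mpoly_induct)
    case (const c)
    have "S_to_minor m (pconst c :: (maya, 'k) mpoly) \<in> carrier (minor_alg m n)"
      unfolding S_to_minor_image[OF assms(1), symmetric] by (intro imageI S_ring_closed)
    then show ?case
      using f g by (simp add: poly_alg_hom_def)
  next
    case (var a)
    have "S_to_minor m (pvar a :: (maya, 'k) mpoly) \<in> carrier (minor_alg m n)"
      unfolding S_to_minor_image[OF assms(1), symmetric]
      by (intro imageI) (use var in \<open>simp add: carrier_S_ring\<close>)
    then show ?case
      using eq[OF maya_rows_in_row_lists[OF var]] by (simp add: d_maya_def)
  next
    case (add p q)
    then have "f (S_to_minor m p \<oplus>\<^bsub>minor_alg m n\<^esub> S_to_minor m q) = g (S_to_minor m p \<oplus>\<^bsub>minor_alg m n\<^esub> S_to_minor m q)"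
      using ring_hom_add[OF f'] ring_hom_add[OF g'] by (simp del: minor_alg_simps)
    then show ?case
      using add R.a_closed by (simp add: S_to_minor.hom_add)
  next
    case (mult p q)
    then have "f (S_to_minor m p \<otimes>\<^bsub>minor_alg m n\<^esub> S_to_minor m q) = g (S_to_minor m p \<otimes>\<^bsub>minor_alg m n\<^esub> S_to_minor m q)"
      using ring_hom_mult[OF f'] ring_hom_mult[OF g'] by (simp del: minor_alg_simps)
    then show ?case
      using mult R.m_closed by (simp add: S_to_minor.hom_mult)
  qed
  with y show "f y = g y" by simp
qed

text \<open>The existence half: the minor algebra is a quotient of \<open>S_ring m n\<close>, and
  two lifts of an element differ by a relation, which the map on S kills. So any choice of
  \<open>lift\<close> gives the same value.\<close>

lemma minor_alg_hom_factor:
  fixes \<psi> :: "(maya, 'k::idom) mpoly \<Rightarrow> (int \<times> int, 'k) mpoly"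
  assumes "0 < m" and \<psi>: "comm_ring_hom \<psi>" "\<And>c. \<psi> (pconst c) = pconst c"
    and closed: "\<And>p. p \<in> carrier (S_ring m n) \<Longrightarrow> \<psi> p \<in> carrier (minor_alg m' n')"
    and kernel: "\<And>p. p \<in> carrier (S_ring m n) \<Longrightarrow> S_to_minor m p = 0 \<Longrightarrow> \<psi> p = 0"
  obtains f where "f \<in> poly_alg_hom (minor_alg m n) (minor_alg m' n')"
    "\<And>p. p \<in> carrier (S_ring m n) \<Longrightarrow> f (S_to_minor m p) = \<psi> p"
proof -
  interpret \<psi>: comm_ring_hom \<psi> by fact
  let ?A = "carrier (minor_alg m n) :: (int \<times> int, 'k) mpoly set"
  define lift where "lift = (\<lambda>y. SOME p :: (maya, 'k) mpoly. p \<in> carrier (S_ring m n) \<and> S_to_minor m p = y)"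
  define f where "f = restrict (\<lambda>y. \<psi> (lift y)) ?A"
  have image: "S_to_minor m ` carrier (S_ring m n) = ?A"
    by (rule S_to_minor_image) fact
  have f: "f (S_to_minor m p) = \<psi> p" if p: "p \<in> carrier (S_ring m n)" for p
  proof -
    have lift: "lift (S_to_minor m p) \<in> carrier (S_ring m n) \<and> S_to_minor m (lift (S_to_minor m p)) = S_to_minor m p"
      unfolding lift_def by (rule someI[of _ p]) (use p in simp)
    then have "\<psi> (lift (S_to_minor m p) - p) = 0"
      using p by (intro kernel S_ring_closed) (auto simp: S_to_minor.hom_minus)
    moreover have "S_to_minor m p \<in> ?A"
      using p image by blast
    ultimately show ?thesis
      by (simp add: f_def \<psi>.hom_minus)
  qed
  have "f \<in> ring_hom (minor_alg m n) (minor_alg m' n')"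
  proof (rule ring_hom_memI)
    fix y z :: "(int \<times> int, 'k) mpoly"
    assume "y \<in> ?A"
    then obtain p where p: "p \<in> carrier (S_ring m n)" "y = S_to_minor m p"
      using image by blast
    then show "f y \<in> carrier (minor_alg m' n')"
      by (simp add: f closed)
    assume "z \<in> ?A"
    then obtain q where q: "q \<in> carrier (S_ring m n)" "z = S_to_minor m q"
      using image by blast
    show "f (y \<otimes>\<^bsub>minor_alg m n\<^esub> z) = f y \<otimes>\<^bsub>minor_alg m' n'\<^esub> f z"
      using f[of "p * q"] p q by (simp add: f S_ring_closed S_to_minor.hom_mult \<psi>.hom_mult)
    show "f (y \<oplus>\<^bsub>minor_alg m n\<^esub> z) = f y \<oplus>\<^bsub>minor_alg m' n'\<^esub> f z"
      using f[of "p + q"] p q by (simp add: f S_ring_closed S_to_minor.hom_add \<psi>.hom_add)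
  next
    show "f \<one>\<^bsub>minor_alg m n\<^esub> = \<one>\<^bsub>minor_alg m' n'\<^esub>"
      using f[of 1] S_ring_closed(1)[of 1 m n] by simp
  qed
  moreover have "f (pconst c) = pconst c" for c
    using f[OF S_ring_closed(1)] by (simp add: \<psi>(2))
  ultimately have "f \<in> poly_alg_hom (minor_alg m n) (minor_alg m' n')"
    by (auto simp: poly_alg_hom_def f_def)
  then show thesis
    using f that by blast
qed

text \<open>The second part says that on lifts \<open>e_map\<close> is the projection of S; this is
  what makes \<open>nat_map_hat\<close> respect the limits.\<close>

lemma e_map:
  assumes "0 < m" "m \<le> m'" "n \<le> n'"
  shows "e_map m' n' m n \<in> poly_alg_hom (minor_alg m' n') (minor_alg m n :: (int \<times> int, 'k::idom) mpoly ring)" (is ?hom)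
    and "p \<in> carrier (S_ring m' n') \<Longrightarrow>
      e_map m' n' m n (S_to_minor m' p) = S_to_minor m (S_proj m n p :: (maya, 'k) mpoly)"
proof -
  obtain f where f: "f \<in> poly_alg_hom (minor_alg m' n') (minor_alg m n :: (int \<times> int, 'k) mpoly ring)"
    and f_eq: "\<And>p. p \<in> carrier (S_ring m' n') \<Longrightarrow> f (S_to_minor m' p) = S_to_minor m (S_proj m n p)"
  proof (rule minor_alg_hom_factor[of m' "\<lambda>p. S_to_minor m (S_proj m n p)" n' m n])
    show "comm_ring_hom (\<lambda>p. S_to_minor m (S_proj m n p) :: (int \<times> int, 'k) mpoly)"
      by unfold_locales (simp_all add: S_to_minor.hom_add S_to_minor.hom_mult S_proj.hom_add S_proj.hom_mult)
    show "S_to_minor m (S_proj m n p) \<in> carrier (minor_alg m n)" for p :: "(maya, 'k) mpoly"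
      unfolding S_to_minor_image[OF assms(1), symmetric] by (intro imageI S_proj_closed)
  qed (use assms in \<open>auto intro: S_to_minor_S_proj\<close>)
  have gens: "f (minor m' (maya_rows m' a)) = S_to_minor m (S_proj m n (pvar a))" if "a \<in> maya_type m' n'" for a
    using f_eq[of "pvar a"] that by (simp add: d_maya_def carrier_S_ring)
  have pad: "f (minor m' (pad m' m ls)) = minor m ls" if ls: "ls \<in> row_lists m n" for ls
  proof -
    obtain a where a: "a \<in> maya_type m n" "maya_rows m a = ls"
      using row_lists_eq_maya_rows[OF assms(1) ls] .
    then show ?thesis
      using gens[of a] maya_type_mono[OF assms(2,3)] maya_rows_pad[OF assms(2) a(1)]
      by (auto simp: d_maya_def)
  qed
  have nonpad: "f (minor m' ls) = 0" if ls: "ls \<in> row_lists m' n' - pad m' m ` row_lists m n" for ls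
  proof -
    obtain a where a: "a \<in> maya_type m' n'" "maya_rows m' a = ls"
      using row_lists_eq_maya_rows[of m' ls n'] ls assms by auto
    then show ?thesis
      using gens[OF a(1)] maya_rows_in_pad_image_iff[OF assms a(1)] ls by simp
  qed
  have "e_map m' n' m n = f"
    unfolding e_map_def
  proof (rule the_equality)
    fix g :: "(int \<times> int, 'k) mpoly \<Rightarrow> (int \<times> int, 'k) mpoly"
    assume g: "g \<in> poly_alg_hom (minor_alg m' n') (minor_alg m n) \<and>
      (\<forall>ls\<in>row_lists m n. g (minor m' (pad m' m ls)) = minor m ls) \<and>
      (\<forall>ls\<in>row_lists m' n' - pad m' m ` row_lists m n. g (minor m' ls) = 0)"
    show "g = f"
    proof (rule minor_alg_hom_eqI[OF _ _ f])
      show "g (minor m' ls) = f (minor m' ls)" if "ls \<in> row_lists m' n'" for ls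
      proof (cases "ls \<in> pad m' m ` row_lists m n")
        case True
        then obtain l where "l \<in> row_lists m n" "ls = pad m' m l"
          by blast
        then show ?thesis
          using g pad[of l] by metis
      next
        case False
        then show ?thesis
          using g nonpad[of ls] that by (metis DiffI)
      qed
      show "0 < m'" using assms by simp
    qed (rule conjunct1[OF g])
  qed (use f pad nonpad in blast)
  with f f_eq show ?hom
    and "p \<in> carrier (S_ring m' n') \<Longrightarrow>
      e_map m' n' m n (S_to_minor m' p) = S_to_minor m (S_proj m n p :: (maya, 'k) mpoly)"
    by simp_all
qed

text \<open>On lifts \<open>r_map\<close> is the inclusion of S: the same polynomial, evaluated at
  larger minors. Well-definedness is fact (R).\<close>

lemma r_map:
  assumes "0 < m" "m \<le> m'" "n \<le> n'"
  shows "r_map m n m' n' \<in> poly_alg_hom (minor_alg m n) (minor_alg m' n' :: (int \<times> int, 'k::idom) mpoly ring)" (is ?hom)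
    and "p \<in> carrier (S_ring m n) \<Longrightarrow>
      r_map m n m' n' (S_to_minor m p) = S_to_minor m' (p :: (maya, 'k) mpoly)"
proof -
  obtain f where f: "f \<in> poly_alg_hom (minor_alg m n) (minor_alg m' n' :: (int \<times> int, 'k) mpoly ring)"
    and f_eq: "\<And>p. p \<in> carrier (S_ring m n) \<Longrightarrow> f (S_to_minor m p) = S_to_minor m' p"
  proof (rule minor_alg_hom_factor[of m "S_to_minor m'" n m' n'])
    have "0 < m'" using assms by simp
    then show "S_to_minor m' p \<in> carrier (minor_alg m' n')" if "p \<in> carrier (S_ring m n)" for p :: "(maya, 'k) mpoly"
      unfolding S_to_minor_image[OF \<open>0 < m'\<close>, symmetric] using that S_ring_mono[OF assms(2,3)] by blast
  qed (use assms in \<open>auto intro: S_to_minor_upward S_to_minor.comm_ring_hom_axioms\<close>)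
  have pad: "f (minor m ls) = minor m' (pad m' m ls)" if ls: "ls \<in> row_lists m n" for ls
  proof -
    obtain a where a: "a \<in> maya_type m n" "maya_rows m a = ls"
      using row_lists_eq_maya_rows[OF assms(1) ls] .
    then show ?thesis
      using f_eq[of "pvar a"] maya_rows_pad[OF assms(2) a(1)]
      by (auto simp: d_maya_def carrier_S_ring)
  qed
  have "r_map m n m' n' = f"
    unfolding r_map_def
  proof (rule the_equality)
    fix g :: "(int \<times> int, 'k) mpoly \<Rightarrow> (int \<times> int, 'k) mpoly"
    assume g: "g \<in> poly_alg_hom (minor_alg m n) (minor_alg m' n') \<and>
      (\<forall>ls\<in>row_lists m n. g (minor m ls) = minor m' (pad m' m ls))"
    show "g = f"
      by (rule minor_alg_hom_eqI[OF assms(1) _ f]) (simp_all add: g pad)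
  qed (use f pad in blast)
  with f f_eq show ?hom
    and "p \<in> carrier (S_ring m n) \<Longrightarrow>
      r_map m n m' n' (S_to_minor m p) = S_to_minor m' (p :: (maya, 'k) mpoly)"
    by simp_all
qed

section \<open>Quotients and inverse limits\<close>

text \<open>The first isomorphism theorem; it reduces (i) and (ii) to surjectivity and the
  computation of a kernel.\<close>

lemma induces_ring_isoI:
  assumes "ring R" "ring S" "h \<in> Ring.ring_hom R S" "h ` carrier R = carrier S"
    and I: "I = a_kernel R S h"
  shows "induces_ring_iso h R I S"
proof -
  interpret ring_hom_ring R S h
    using assms(1-3) by (rule ring_hom_ringI2)
  show ?thesis
    unfolding induces_ring_iso_def I
  proof (intro conjI bexI ballI)
    show "h \<in> Ring.ring_hom R S" by fact
    show "ideal (a_kernel R S h) R"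
      by (rule kernel_is_ideal)
    show "(\<lambda>X. the_elem (h ` X)) \<in> ring_iso (R Quot a_kernel R S h) S"
      by (rule FactRing_iso_set) fact
    show "the_elem (h ` (a_kernel R S h +>\<^bsub>R\<^esub> x)) = h x" if "x \<in> carrier R" for x
      using that by simp
  qed
qed

lemma ring_inv_limit:
  assumes R: "\<And>i. i \<in> I \<Longrightarrow> ring (R i)"
    and f: "\<And>i j. i \<in> I \<Longrightarrow> j \<in> I \<Longrightarrow> leq i j \<Longrightarrow> f j i \<in> Ring.ring_hom (R j) (R i)"
  shows "ring (inv_limit I leq R f)" (is "ring ?L")
proof -
  have ext: "x = y" if "x \<in> carrier ?L" "y \<in> carrier ?L" "\<And>i. i \<in> I \<Longrightarrow> x i = y i" for x y
    using that by (intro PiE_ext[of x I "\<lambda>i. carrier (R i)"]) (auto simp: inv_limit_def)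
  have mem: "x i \<in> carrier (R i)" if "x \<in> carrier ?L" "i \<in> I" for x i
    using that by (auto simp: inv_limit_def)
  have memI: "(\<lambda>i\<in>I. g i) \<in> carrier ?L"
    if "\<And>i. i \<in> I \<Longrightarrow> g i \<in> carrier (R i)"
      "\<And>i j. i \<in> I \<Longrightarrow> j \<in> I \<Longrightarrow> leq i j \<Longrightarrow> f j i (g j) = g i" for g
    using that by (auto simp: inv_limit_def)
  have compat: "f j i (x j) = x i" if "x \<in> carrier ?L" "i \<in> I" "j \<in> I" "leq i j" for x i j
    using that by (auto simp: inv_limit_def)
  have simps:
    "mult ?L = (\<lambda>x y. \<lambda>i\<in>I. x i \<otimes>\<^bsub>R i\<^esub> y i)" "one ?L = (\<lambda>i\<in>I. \<one>\<^bsub>R i\<^esub>)"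
    "zero ?L = (\<lambda>i\<in>I. \<zero>\<^bsub>R i\<^esub>)" "add ?L = (\<lambda>x y. \<lambda>i\<in>I. x i \<oplus>\<^bsub>R i\<^esub> y i)"
    by (simp_all add: inv_limit_def)
  have zero: "\<zero>\<^bsub>?L\<^esub> \<in> carrier ?L"
    unfolding simps by (intro memI) (auto simp: R ring.ring_simprules ring_hom_zero[OF f])
  have one: "\<one>\<^bsub>?L\<^esub> \<in> carrier ?L"
    unfolding simps by (intro memI) (auto simp: R ring.ring_simprules ring_hom_one[OF f])
  have add: "x \<oplus>\<^bsub>?L\<^esub> y \<in> carrier ?L" if "x \<in> carrier ?L" "y \<in> carrier ?L" for x y
    unfolding simps
    by (intro memI) (use that in \<open>auto simp: R mem compat ring.ring_simprules ring_hom_add[OF f]\<close>)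
  have mult: "x \<otimes>\<^bsub>?L\<^esub> y \<in> carrier ?L" if "x \<in> carrier ?L" "y \<in> carrier ?L" for x y
    unfolding simps
    by (intro memI) (use that in \<open>auto simp: R mem compat ring.ring_simprules ring_hom_mult[OF f]\<close>)
  have inv: "(\<lambda>i\<in>I. \<ominus>\<^bsub>R i\<^esub> x i) \<in> carrier ?L" if x: "x \<in> carrier ?L" for x
  proof (intro memI)
    fix i j assume ij: "i \<in> I" "j \<in> I" "leq i j"
    then interpret ring_hom_ring "R j" "R i" "f j i"
      by (intro ring_hom_ringI2 R f)
    show "f j i (\<ominus>\<^bsub>R j\<^esub> x j) = \<ominus>\<^bsub>R i\<^esub> x i"
      using x ij by (simp add: mem compat)
  qed (use x in \<open>simp add: R mem ring.ring_simprules\<close>)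
  note closed = zero one add mult
  have app: "(x \<oplus>\<^bsub>?L\<^esub> y) i = x i \<oplus>\<^bsub>R i\<^esub> y i" "(x \<otimes>\<^bsub>?L\<^esub> y) i = x i \<otimes>\<^bsub>R i\<^esub> y i"
    "\<zero>\<^bsub>?L\<^esub> i = \<zero>\<^bsub>R i\<^esub>" "\<one>\<^bsub>?L\<^esub> i = \<one>\<^bsub>R i\<^esub>" if "i \<in> I" for x y i
    using that by (simp_all add: simps)
  show ?thesis
  proof (rule ringI)
    show "abelian_group ?L"
    proof (rule abelian_groupI)
      fix x assume x: "x \<in> carrier ?L"
      show "\<exists>y\<in>carrier ?L. y \<oplus>\<^bsub>?L\<^esub> x = \<zero>\<^bsub>?L\<^esub>"
        by (rule bexI[OF _ inv[OF x]], unfold simps, rule restrict_ext)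
          (use x in \<open>simp add: R mem ring.ring_simprules\<close>)
    qed (auto intro!: closed ext simp: app R mem ring.ring_simprules monoid.r_one[OF ring.is_monoid])
    show "Group.monoid ?L"
      by (rule monoidI) (auto intro!: closed ext simp: app R mem ring.ring_simprules monoid.r_one[OF ring.is_monoid])
  qed (auto intro!: closed ext simp: app R mem ring.ring_simprules monoid.r_one[OF ring.is_monoid])
qed

section \<open>The natural map between the two inverse limits\<close>

lemma idx_pairs_iff: "(m, n) \<in> idx_pairs \<longleftrightarrow> 0 < m \<and> 0 < n"
  by (auto simp: idx_pairs_def)

lemma idx_pairs_iff': "i \<in> idx_pairs \<longleftrightarrow> 0 < fst i \<and> 0 < snd i"
  by (cases i) (simp add: idx_pairs_iff)

lemma ball_idx_pairs: "(\<forall>i \<in> idx_pairs. P i) \<longleftrightarrow> (\<forall>m n. 0 < m \<longrightarrow> 0 < n \<longrightarrow> P (m, n))"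
  by (auto simp: idx_pairs_iff)

lemma bex_idx_pairs: "(\<exists>i \<in> idx_pairs. P i) \<longleftrightarrow> (\<exists>m n. 0 < m \<and> 0 < n \<and> P (m, n))"
  by (force simp: idx_pairs_iff)

lemma poly_alg_hom_ring_hom: "f \<in> poly_alg_hom A B \<Longrightarrow> f \<in> Ring.ring_hom A B"
  by (simp add: poly_alg_hom_def)

lemma ring_xi_hat: "ring (xi_hat :: (nat \<times> nat \<Rightarrow> (maya, 'k::comm_ring_1) mpoly) ring)"
  unfolding xi_hat_def
  by (rule ring_inv_limit)
    (auto simp: ring_S_ring S_proj_closed S_proj.hom_add S_proj.hom_mult intro!: ring_hom_memI)

lemma ring_delta_hat: "ring (delta_hat :: (nat \<times> nat \<Rightarrow> (int \<times> int, 'k::idom) mpoly) ring)"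
  unfolding delta_hat_def
  by (rule ring_inv_limit)
    (auto simp: ring_minor_alg idx_pairs_iff idx_le_def intro!: poly_alg_hom_ring_hom e_map(1))

lemma carrier_xi_hat:
  "x \<in> carrier xi_hat \<longleftrightarrow>
    (\<forall>m n. 0 < m \<longrightarrow> 0 < n \<longrightarrow> x (m, n) \<in> carrier (S_ring m n)) \<and> x \<in> extensional idx_pairs \<and>
    (\<forall>m n. 0 < m \<longrightarrow> 0 < n \<longrightarrow> (\<forall>m' n'. 0 < m' \<longrightarrow> 0 < n' \<longrightarrow> m \<le> m' \<and> n \<le> n' \<longrightarrow> S_proj m n (x (m', n')) = x (m, n)))"
  by (simp add: xi_hat_def inv_limit_def PiE_iff ball_idx_pairs idx_le_def)

lemma carrier_delta_hat:
  "y \<in> carrier delta_hat \<longleftrightarrow>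
    (\<forall>m n. 0 < m \<longrightarrow> 0 < n \<longrightarrow> y (m, n) \<in> carrier (minor_alg m n)) \<and> y \<in> extensional idx_pairs \<and>
    (\<forall>m n. 0 < m \<longrightarrow> 0 < n \<longrightarrow> (\<forall>m' n'. 0 < m' \<longrightarrow> 0 < n' \<longrightarrow> m \<le> m' \<and> n \<le> n' \<longrightarrow> e_map m' n' m n (y (m', n')) = y (m, n)))"
  by (simp add: delta_hat_def inv_limit_def PiE_iff ball_idx_pairs idx_le_def)

lemma nat_map_hat_apply: "0 < m \<Longrightarrow> 0 < n \<Longrightarrow> nat_map_hat x (m, n) = S_to_minor m (x (m, n))"
  by (simp add: nat_map_hat_def idx_pairs_iff)

lemma nat_map_hat_closed:
  assumes "x \<in> carrier xi_hat"
  shows "nat_map_hat x \<in> carrier (delta_hat :: (nat \<times> nat \<Rightarrow> (int \<times> int, 'k::idom) mpoly) ring)"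
  unfolding carrier_delta_hat
proof (intro conjI allI impI)
  show "nat_map_hat x \<in> extensional idx_pairs"
    by (simp add: nat_map_hat_def)
  fix m n :: nat assume mn: "0 < m" "0 < n"
  then show "nat_map_hat x (m, n) \<in> carrier (minor_alg m n)"
    using assms by (simp add: nat_map_hat_apply carrier_xi_hat flip: S_to_minor_image)
  fix m' n' assume "m \<le> m' \<and> n \<le> n'"
  then show "e_map m' n' m n (nat_map_hat x (m', n')) = nat_map_hat x (m, n)"
    using assms mn by (simp add: nat_map_hat_apply carrier_xi_hat e_map(2))
qed

lemma nat_map_hat_hom:
  "nat_map_hat \<in> Ring.ring_hom xi_hat (delta_hat :: (nat \<times> nat \<Rightarrow> (int \<times> int, 'k::idom) mpoly) ring)"
  by (rule ring_hom_memI)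
    (auto simp: nat_map_hat_closed,
     auto simp: nat_map_hat_def xi_hat_def delta_hat_def inv_limit_def fun_eq_iff
      S_to_minor.hom_add S_to_minor.hom_mult)

text \<open>A Mittag-Leffler argument along the diagonal: a relation of type \<open>(k, k)\<close> is also one of
  type \<open>(k + 1, k + 1)\<close>, so any lift at level \<open>k + 1\<close> can be corrected by a relation to become
  compatible with the lift at level \<open>k\<close>.\<close>

lemma nat_map_hat_surj:
  assumes y: "y \<in> carrier (delta_hat :: (nat \<times> nat \<Rightarrow> (int \<times> int, 'k::idom) mpoly) ring)"
  obtains x where "x \<in> carrier xi_hat" "nat_map_hat x = y"
proof -
  have "\<exists>p. p \<in> carrier (S_ring (Suc k) (Suc k)) \<and> S_to_minor (Suc k) p = y (Suc k, Suc k)" for k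
  proof -
    have "y (Suc k, Suc k) \<in> S_to_minor (Suc k) ` carrier (S_ring (Suc k) (Suc k))"
      using y by (simp add: carrier_delta_hat S_to_minor_image)
    then show ?thesis by force
  qed
  then obtain z where z: "\<And>k. z k \<in> carrier (S_ring (Suc k) (Suc k))"
    "\<And>k. S_to_minor (Suc k) (z k) = y (Suc k, Suc k)"
    by metis
  \<comment> \<open>Each chosen lift is corrected by its defect against the previous one. The index
    is shifted: \<open>X k\<close> has type (k + 1, k + 1), because types start at 1.\<close>
  define X where "X = rec_nat (z 0) (\<lambda>k q. z (Suc k) - (S_proj (Suc k) (Suc k) (z (Suc k)) - q))"
  have X_simps: "X 0 = z 0" "X (Suc k) = z (Suc k) - (S_proj (Suc k) (Suc k) (z (Suc k)) - X k)" for k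
    by (simp_all add: X_def)
  have X: "X k \<in> carrier (S_ring (Suc k) (Suc k)) \<and> S_to_minor (Suc k) (X k) = y (Suc k, Suc k)" for k
  proof (induction k)
    case 0
    show ?case by (simp add: X_simps z)
  next
    case (Suc k)
    let ?d = "S_proj (Suc k) (Suc k) (z (Suc k)) - X k"
    have d: "?d \<in> carrier (S_ring (Suc k) (Suc k))"
      using Suc by (intro S_ring_closed S_proj_closed) simp
    have "S_to_minor (Suc k) (S_proj (Suc k) (Suc k) (z (Suc k))) = y (Suc k, Suc k)"
      using e_map(2)[OF _ _ _ z(1), of "Suc k" "Suc k" "Suc k", symmetric] y
      by (simp add: z(2) carrier_delta_hat)
    then have "S_to_minor (Suc k) ?d = 0"
      using Suc by (simp add: S_to_minor.hom_minus)
    then have "S_to_minor (Suc (Suc k)) ?d = 0"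
      by (rule S_to_minor_upward[OF _ _ d, rotated 2]) simp_all
    moreover have "?d \<in> carrier (S_ring (Suc (Suc k)) (Suc (Suc k)))"
      using d S_ring_mono[of "Suc k" "Suc (Suc k)" "Suc k" "Suc (Suc k)"] by auto
    ultimately show ?case
      using z[of "Suc k"] by (simp add: X_simps S_ring_closed S_to_minor.hom_minus)
  qed
  \<comment> \<open>The projection is idempotent and fixes \<open>X k\<close>, so the two terms in
    \<open>z (Suc k)\<close> cancel.\<close>
  have step: "S_proj (Suc k) (Suc k) (X (Suc k)) = X k" for k
    using X[of k] by (simp add: X_simps S_proj.hom_minus S_proj_id S_proj_S_proj)
  have compat: "S_proj (Suc j) (Suc j) (X k) = X j" if "j \<le> k" for j k
    using that
  proof (induction k rule: dec_induct)
    case base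
    show ?case using X by (simp add: S_proj_id)
  next
    case (step k)
    then show ?case
      using S_proj_S_proj[of "Suc j" "Suc k" "Suc j" "Suc k" "X (Suc k)"] \<open>\<And>k. S_proj _ _ (X (Suc k)) = X k\<close>
      by simp
  qed
  \<comment> \<open>The diagonal is cofinal: the component at (m, n) is projected from type (N, N)
    with N = max m n, where \<open>X (N - 1)\<close> lives.\<close>
  define x where "x = (\<lambda>(m, n) \<in> idx_pairs. S_proj m n (X (max m n - 1)))"
  have x: "x (m, n) = S_proj m n (X (max m n - 1))" if "0 < m" "0 < n" for m n
    using that by (simp add: x_def idx_pairs_iff)
  show thesis
  proof
    show "x \<in> carrier xi_hat"
      unfolding carrier_xi_hat
    proof (intro conjI allI impI)
      show "x \<in> extensional idx_pairs"
        by (simp add: x_def)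
      fix m n :: nat assume mn: "0 < m" "0 < n"
      then show "x (m, n) \<in> carrier (S_ring m n)"
        by (simp add: x S_proj_closed)
      fix m' n' :: nat assume "0 < m'" "0 < n'" and le: "m \<le> m' \<and> n \<le> n'"
      have "S_proj m n (x (m', n')) = S_proj m n (X (max m' n' - 1))"
        using mn le by (simp add: x S_proj_S_proj)
      also have "\<dots> = S_proj m n (S_proj (max m n) (max m n) (X (max m' n' - 1)))"
        by (simp add: S_proj_S_proj)
      also have "S_proj (max m n) (max m n) (X (max m' n' - 1)) = X (max m n - 1)"
        using compat[of "max m n - 1" "max m' n' - 1"] mn le by (auto simp: Suc_diff_le max_def)
      finally show "S_proj m n (x (m', n')) = x (m, n)"
        using mn by (simp add: x)
    qed
    show "nat_map_hat x = y"
    proof (rule extensionalityI[of _ idx_pairs])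
      show "nat_map_hat x \<in> extensional idx_pairs" "y \<in> extensional idx_pairs"
        using y by (simp_all add: nat_map_hat_def carrier_delta_hat)
      fix i assume "i \<in> idx_pairs"
      then obtain m n where i: "i = (m, n)" and mn: "0 < m" "0 < n"
        by (cases i) (auto simp: idx_pairs_iff)
      let ?k = "max m n - 1"
      have k: "Suc ?k = max m n" using mn by simp
      have "S_to_minor m (S_proj m n (X ?k)) = e_map (Suc ?k) (Suc ?k) m n (S_to_minor (Suc ?k) (X ?k))"
        using mn X[of ?k] by (intro e_map(2)[symmetric]) (auto simp: k)
      also have "\<dots> = e_map (Suc ?k) (Suc ?k) m n (y (Suc ?k, Suc ?k))"
        using X[of ?k] by simp
      also have "\<dots> = y (m, n)"
        using y mn by (auto simp: k carrier_delta_hat)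
      finally show "nat_map_hat x i = y i"
        using mn by (simp add: i nat_map_hat_apply x)
    qed
  qed
qed

lemma pluecker_iff: "p \<in> pluecker m n \<longleftrightarrow> p \<in> carrier (S_ring m n) \<and> S_to_minor m p = 0"
  by (auto simp: pluecker_def a_kernel_def')

lemma P_hat_eq_kernel:
  "P_hat = a_kernel xi_hat (delta_hat :: (nat \<times> nat \<Rightarrow> (int \<times> int, 'k::idom) mpoly) ring) nat_map_hat"
proof -
  have "(\<forall>(m, n) \<in> idx_pairs. x (m, n) \<in> pluecker m n) \<longleftrightarrow>
      nat_map_hat x = \<zero>\<^bsub>delta_hat :: (nat \<times> nat \<Rightarrow> (int \<times> int, 'k) mpoly) ring\<^esub>"
    if "x \<in> carrier xi_hat" for x
    using that
    by (auto simp: carrier_xi_hat pluecker_iff delta_hat_def inv_limit_def nat_map_hat_def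
        fun_eq_iff idx_pairs_iff restrict_def)
  then show ?thesis
    by (auto simp: P_hat_def a_kernel_def')
qed

lemma nat_map_hat_var: "nat_map_hat (xi_hat_var a) = d_hat a"
  by (auto simp: nat_map_hat_def xi_hat_var_def d_hat_def fun_eq_iff restrict_def)

theorem nat_map_hat_induces_iso:
  "induces_ring_iso nat_map_hat xi_hat P_hat
    (delta_hat :: (nat \<times> nat \<Rightarrow> (int \<times> int, 'k::idom) mpoly) ring)"
proof (rule induces_ring_isoI[OF ring_xi_hat ring_delta_hat nat_map_hat_hom _ P_hat_eq_kernel])
  show "nat_map_hat ` carrier xi_hat = carrier (delta_hat :: (nat \<times> nat \<Rightarrow> (int \<times> int, 'k) mpoly) ring)"
    using nat_map_hat_closed nat_map_hat_surj by blast
qed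

section \<open>The direct limit\<close>

lemma maya_has_type: "\<exists>m n. a \<in> maya_type m n"
proof -
  obtain N where "\<forall>i\<ge>N. maya_seq a i = int i + 1"
    using maya_seq[of a] by auto
  then have "a \<in> maya_type N (nat (1 - maya_seq a 0))"
    by (simp add: maya_type_def)
  then show ?thesis by blast
qed

text \<open>Only finitely many diagrams occur in a polynomial, and the types are directed under
  componentwise maximum.\<close>

lemma obtain_S_ring:
  obtains m n where "0 < m" "0 < n" "p \<in> carrier (S_ring m n)"
proof -
  have "\<exists>m n. 0 < m \<and> 0 < n \<and> A \<subseteq> maya_type m n" if "finite A" for A
    using that
  proof induction
    case (insert a A)
    then obtain m n where mn: "0 < m" "0 < n" "A \<subseteq> maya_type m n" by blast
    obtain m' n' where mn': "a \<in> maya_type m' n'" using maya_has_type by blast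
    have "insert a A \<subseteq> maya_type (max m m') (max n n')"
      using mn(3) mn' maya_type_mono[of m "max m m'" n "max n n'"]
        maya_type_mono[of m' "max m m'" n' "max n n'"] by auto
    then show ?case
      using mn by (meson less_max_iff_disj)
  qed auto
  from this[OF finite_pvars, of p] show thesis
    using that by (auto simp: carrier_S_ring)
qed

section \<open>The ideal P as a directed union\<close>

lemma P_infty_iff:
  "u \<in> P_infty \<longleftrightarrow> (\<exists>m n. 0 < m \<and> 0 < n \<and> u \<in> carrier (S_ring m n) \<and> S_to_minor m u = 0)"
  by (simp add: P_infty_def bex_idx_pairs pluecker_iff)

lemma P_inftyI:
  "0 < m \<Longrightarrow> 0 < n \<Longrightarrow> u \<in> carrier (S_ring m n) \<Longrightarrow> S_to_minor m u = 0 \<Longrightarrow> u \<in> P_infty"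
  by (auto simp: P_infty_iff)

text \<open>By (R) a relation persists at all larger types, so it can be combined with other
  relations or polynomials at a common level.\<close>

lemma P_infty_cofinal:
  fixes u :: "(maya, 'k::idom) mpoly"
  assumes "u \<in> P_infty"
  obtains m n where "m\<^sub>0 \<le> m" "n\<^sub>0 \<le> n" "0 < m" "0 < n" "u \<in> carrier (S_ring m n)" "S_to_minor m u = 0"
proof -
  obtain m n where *: "0 < m" "0 < n" "u \<in> carrier (S_ring m n)" "S_to_minor m u = 0"
    using assms by (auto simp: P_infty_iff)
  show thesis
  proof
    show "u \<in> carrier (S_ring (max m m\<^sub>0) (max n n\<^sub>0))"
      using * S_ring_mono[of m "max m m\<^sub>0" n "max n n\<^sub>0"] by auto
    show "S_to_minor (max m m\<^sub>0) u = 0"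
      using * by (intro S_to_minor_upward[OF _ _ *(3,4)]) auto
  qed (use * in auto)
qed

lemma P_infty_zero: "0 \<in> P_infty"
  unfolding P_infty_iff using S_ring_closed(1)[of 0] by (intro exI[of _ 1]) auto

lemma P_infty_add:
  fixes u v :: "(maya, 'k::idom) mpoly"
  assumes "u \<in> P_infty" "v \<in> P_infty"
  shows "u + v \<in> P_infty"
proof -
  obtain m n where u: "0 < m" "0 < n" "u \<in> carrier (S_ring m n)" "S_to_minor m u = 0"
    using assms(1) by (auto simp: P_infty_iff)
  obtain m' n' where v: "m \<le> m'" "n \<le> n'" "v \<in> carrier (S_ring m' n')" "S_to_minor m' v = 0"
    using P_infty_cofinal[OF assms(2)] by metis
  have "u \<in> carrier (S_ring m' n')" "S_to_minor m' u = 0"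
    using u v S_ring_mono[of m m' n n'] S_to_minor_upward[of m m' u n] by auto
  with u v show ?thesis
    by (intro P_inftyI[of m' n']) (simp_all add: S_ring_closed S_to_minor.hom_add)
qed

lemma P_infty_uminus:
  assumes "u \<in> P_infty"
  shows "- u \<in> P_infty"
proof -
  obtain m n where "0 < m" "0 < n" "u \<in> carrier (S_ring m n)" "S_to_minor m u = 0"
    using assms by (auto simp: P_infty_iff)
  then show ?thesis
    by (intro P_inftyI[of m n]) (simp_all add: S_ring_closed S_to_minor.hom_uminus)
qed

lemma P_infty_mult:
  fixes u p :: "(maya, 'k::idom) mpoly"
  assumes "u \<in> P_infty"
  shows "u * p \<in> P_infty"
proof -
  obtain m n where p: "0 < m" "0 < n" "p \<in> carrier (S_ring m n)"
    by (rule obtain_S_ring)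
  obtain m' n' where u: "m \<le> m'" "n \<le> n'" "u \<in> carrier (S_ring m' n')" "S_to_minor m' u = 0"
    using P_infty_cofinal[OF assms] by metis
  have "p \<in> carrier (S_ring m' n')"
    using u p S_ring_mono[of m m' n n'] by auto
  with u p show ?thesis
    by (intro P_inftyI[of m' n']) (simp_all add: S_ring_closed S_to_minor.hom_mult)
qed

text \<open>The natural map of (ii), given without transition maps. Elements of
  \<open>dir_limit\<close> are sets of representatives, and this one collects the images of all
  polynomials congruent to \<open>p\<close> modulo P.\<close>

definition xi_class :: "(maya, 'k::comm_ring_1) mpoly \<Rightarrow> ((nat \<times> nat) \<times> (int \<times> int, 'k) mpoly) set" where
  "xi_class p = {((m, n), S_to_minor m q) | m n q. 0 < m \<and> 0 < n \<and> q \<in> carrier (S_ring m n) \<and> p - q \<in> P_infty}"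

lemma xi_class_cong:
  fixes p q :: "(maya, 'k::idom) mpoly"
  assumes "p - q \<in> P_infty"
  shows "xi_class p = xi_class q"
proof -
  have "p - r \<in> P_infty \<longleftrightarrow> q - r \<in> P_infty" for r
    using P_infty_add[OF assms, of "q - r"] P_infty_add[OF P_infty_uminus[OF assms], of "p - r"] by auto
  then show ?thesis
    by (simp add: xi_class_def)
qed

lemma self_in_xi_class:
  "0 < m \<Longrightarrow> 0 < n \<Longrightarrow> p \<in> carrier (S_ring m n) \<Longrightarrow> ((m, n), S_to_minor m p) \<in> xi_class p"
  using P_infty_zero by (force simp: xi_class_def)

text \<open>Injectivity in (ii). A representative of \<open>p\<close> at some level is also the
  image of an \<open>r\<close> congruent to \<open>q\<close>; then p - r is a relation at that very
  level, so \<open>p\<close> and \<open>q\<close> are congruent.\<close>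

lemma xi_class_eq_iff:
  fixes p q :: "(maya, 'k::idom) mpoly"
  shows "xi_class p = xi_class q \<longleftrightarrow> p - q \<in> P_infty"
proof
  assume eq: "xi_class p = xi_class q"
  obtain m n where mn: "0 < m" "0 < n" "p \<in> carrier (S_ring m n)"
    by (rule obtain_S_ring)
  then have "((m, n), S_to_minor m p) \<in> xi_class q"
    using self_in_xi_class eq by metis
  then obtain r where r: "r \<in> carrier (S_ring m n)" "S_to_minor m p = S_to_minor m r" "q - r \<in> P_infty"
    by (auto simp: xi_class_def)
  have "p - r \<in> P_infty"
    using mn r by (intro P_inftyI[of m n]) (simp_all add: S_ring_closed S_to_minor.hom_minus)
  then show "p - q \<in> P_infty"
    using P_infty_add[OF _ P_infty_uminus[OF r(3)], of "p - r"] by simp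
qed (rule xi_class_cong)

text \<open>Since \<open>r_map\<close> is inclusion on lifts, two elements become equal at a larger
  level exactly when the difference of their lifts is a relation there. Hence the class does not see
  the type (m, n).\<close>

lemma delta_class_S_to_minor:
  fixes p :: "(maya, 'k::idom) mpoly"
  assumes mn: "0 < m" "0 < n" and p: "p \<in> carrier (S_ring m n)"
  shows "delta_class m n (S_to_minor m p) = xi_class p"
proof (intro subset_antisym subsetI)
  fix z assume "z \<in> delta_class m n (S_to_minor m p)"
  then obtain m1 n1 y m2 n2 where z: "z = ((m1, n1), y)" and "0 < m1" "0 < n1"
    and y: "y \<in> carrier (minor_alg m1 n1)" and le: "m \<le> m2" "n \<le> n2" "m1 \<le> m2" "n1 \<le> n2"
    and eq: "r_map m n m2 n2 (S_to_minor m p) = r_map m1 n1 m2 n2 y"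
    by (auto simp: delta_class_def dir_class_def idx_pairs_iff idx_le_def)
  from y obtain q where q: "q \<in> carrier (S_ring m1 n1)" "y = S_to_minor m1 q"
    using S_to_minor_image[OF \<open>0 < m1\<close>] by blast
  have "S_to_minor m2 p = S_to_minor m2 q"
    using eq q p le mn \<open>0 < m1\<close> by (simp add: r_map(2))
  moreover have "p \<in> carrier (S_ring m2 n2)" "q \<in> carrier (S_ring m2 n2)"
    using p q S_ring_mono[of m m2 n n2] S_ring_mono[of m1 m2 n1 n2] le by auto
  ultimately have "p - q \<in> P_infty"
    using mn le by (intro P_inftyI[of m2 n2]) (simp_all add: S_ring_closed S_to_minor.hom_minus)
  with q show "z \<in> xi_class p"
    using z \<open>0 < m1\<close> \<open>0 < n1\<close> by (auto simp: xi_class_def)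
next
  fix z assume "z \<in> xi_class p"
  then obtain m1 n1 q where z: "z = ((m1, n1), S_to_minor m1 q)" and mn1: "0 < m1" "0 < n1"
    and q: "q \<in> carrier (S_ring m1 n1)" and "p - q \<in> P_infty"
    by (auto simp: xi_class_def)
  from P_infty_cofinal[OF this(5)] obtain m2 n2 where le: "max m m1 \<le> m2" "max n n1 \<le> n2"
    and eq: "S_to_minor m2 (p - q) = 0"
    by metis
  have "r_map m n m2 n2 (S_to_minor m p) = r_map m1 n1 m2 n2 (S_to_minor m1 q)"
    using eq le mn mn1 p q by (simp add: r_map(2) S_to_minor.hom_minus)
  moreover have "S_to_minor m1 q \<in> carrier (minor_alg m1 n1)"
    using q S_to_minor_image[OF mn1(1)] by blast
  ultimately show "z \<in> delta_class m n (S_to_minor m p)"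
    using le mn mn1 unfolding z delta_class_def dir_class_def
    by (auto simp: idx_pairs_iff idx_le_def intro!: bexI[of _ "(m2, n2)"])
qed

text \<open>Treats sum and product of the direct limit at once: the union over all representatives
  is nonempty and all its members coincide, as \<open>g\<close> respects congruence modulo
  P.\<close>

lemma xi_class_op:
  fixes p q :: "(maya, 'k::idom) mpoly"
    and g :: "(maya, 'k) mpoly \<Rightarrow> (maya, 'k) mpoly \<Rightarrow> (maya, 'k) mpoly"
    and g' :: "(int \<times> int, 'k) mpoly \<Rightarrow> (int \<times> int, 'k) mpoly \<Rightarrow> (int \<times> int, 'k) mpoly"
  assumes hom: "\<And>m p q. S_to_minor m (g p q) = g' (S_to_minor m p) (S_to_minor m q)"
    and closed: "\<And>m n p q. p \<in> carrier (S_ring m n) \<Longrightarrow> q \<in> carrier (S_ring m n) \<Longrightarrow> g p q \<in> carrier (S_ring m n)"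
    and cong: "\<And>p q p' q'. p - p' \<in> P_infty \<Longrightarrow> q - q' \<in> P_infty \<Longrightarrow> g p q - g p' q' \<in> P_infty"
  shows "(\<Union>((m1, n1), x) \<in> xi_class p. \<Union>((m2, n2), y) \<in> xi_class q.
      \<Union>(m, n) \<in> {(m, n). 0 < m \<and> 0 < n \<and> m1 \<le> m \<and> n1 \<le> n \<and> m2 \<le> m \<and> n2 \<le> n}.
        delta_class m n (g' (r_map m1 n1 m n x) (r_map m2 n2 m n y))) = xi_class (g p q)"
    (is "?L = _")
proof -
  have *: "delta_class m n (g' (r_map m1 n1 m n x) (r_map m2 n2 m n y)) = xi_class (g p q)"
    if x: "((m1, n1), x) \<in> xi_class p" and y: "((m2, n2), y) \<in> xi_class q"
      and le: "m1 \<le> m" "n1 \<le> n" "m2 \<le> m" "n2 \<le> n" for m1 n1 m2 n2 m n x y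
  proof -
    obtain p' where p': "x = S_to_minor m1 p'" "0 < m1" "0 < n1" "p' \<in> carrier (S_ring m1 n1)" "p - p' \<in> P_infty"
      using x by (auto simp: xi_class_def)
    obtain q' where q': "y = S_to_minor m2 q'" "0 < m2" "q' \<in> carrier (S_ring m2 n2)" "q - q' \<in> P_infty"
      using y by (auto simp: xi_class_def)
    have "p' \<in> carrier (S_ring m n)" "q' \<in> carrier (S_ring m n)"
      using p' q' le S_ring_mono[of m1 m n1 n] S_ring_mono[of m2 m n2 n] by auto
    then have "delta_class m n (S_to_minor m (g p' q')) = xi_class (g p' q')"
      using p' le by (intro delta_class_S_to_minor closed) auto
    also have "\<dots> = xi_class (g p q)"
      using cong[OF p'(5) q'(4)] by (simp add: xi_class_eq_iff[symmetric])
    finally show ?thesis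
      using p' q' le by (simp add: r_map(2) hom)
  qed
  obtain m1 n1 where mn1: "0 < m1" "0 < n1" "p \<in> carrier (S_ring m1 n1)"
    by (rule obtain_S_ring)
  obtain m2 n2 where mn2: "0 < m2" "0 < n2" "q \<in> carrier (S_ring m2 n2)"
    by (rule obtain_S_ring)
  show ?thesis
  proof
    show "?L \<subseteq> xi_class (g p q)"
      by (auto simp: *)
    show "xi_class (g p q) \<subseteq> ?L"
    proof
      fix z assume z: "z \<in> xi_class (g p q)"
      \<comment> \<open>Nonemptiness: \<open>p\<close> and \<open>q\<close> have representatives at
        some levels, which meet at the componentwise maximum.\<close>
      have "z \<in> delta_class (max m1 m2) (max n1 n2)
          (g' (r_map m1 n1 (max m1 m2) (max n1 n2) (S_to_minor m1 p))
            (r_map m2 n2 (max m1 m2) (max n1 n2) (S_to_minor m2 q)))"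
        using z by (subst *[OF self_in_xi_class[OF mn1] self_in_xi_class[OF mn2]]) auto
      then show "z \<in> ?L"
        by (intro UN_I[OF self_in_xi_class[OF mn1]], unfold prod.case,
            intro UN_I[OF self_in_xi_class[OF mn2]], unfold prod.case,
            intro UN_I[of "(max m1 m2, max n1 n2)"])
          (simp_all add: mn1 mn2 less_max_iff_disj)
    qed
  qed
qed

section \<open>The ring structure of the direct limit in terms of classes\<close>

lemma delta_infty_mult:
  fixes p q :: "(maya, 'k::idom) mpoly"
  shows "xi_class p \<otimes>\<^bsub>delta_infty\<^esub> xi_class q = xi_class (p * q)"
proof -
  have "p * q - p' * q' \<in> P_infty" if "p - p' \<in> P_infty" "q - q' \<in> P_infty" for p q p' q' :: "(maya, 'k) mpoly"
    using P_infty_add[OF P_infty_mult[OF that(1), of q] P_infty_mult[OF that(2), of p']]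
    by (simp add: algebra_simps)
  note op = xi_class_op[of "(*)" "(*)", OF S_to_minor.hom_mult S_ring_closed(4) this]
  show ?thesis
    using op[where p = p and q = q]
    by (simp add: delta_infty_def dir_limit_def Let_def delta_class_def split_def idx_pairs_iff'
        idx_le_def conj_assoc)
qed

lemma delta_infty_add:
  fixes p q :: "(maya, 'k::idom) mpoly"
  shows "xi_class p \<oplus>\<^bsub>delta_infty\<^esub> xi_class q = xi_class (p + q)"
proof -
  have "(p + q) - (p' + q') \<in> P_infty" if "p - p' \<in> P_infty" "q - q' \<in> P_infty" for p q p' q' :: "(maya, 'k) mpoly"
    using P_infty_add[OF that] by (simp add: algebra_simps)
  note op = xi_class_op[of "(+)" "(+)", OF S_to_minor.hom_add S_ring_closed(2) this]
  show ?thesis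
    using op[where p = p and q = q]
    by (simp add: delta_infty_def dir_limit_def Let_def delta_class_def split_def idx_pairs_iff'
        idx_le_def conj_assoc)
qed

text \<open>All classes in the union are equal, and (1, 1) shows that the union is not empty. The
  cases 1 and 0 identify the constants of the direct limit.\<close>

lemma const_infty_eq: "const_infty c = xi_class (pconst c :: (maya, 'k::idom) mpoly)"
proof -
  have "delta_class m n (pconst c) = xi_class (pconst c :: (maya, 'k::idom) mpoly)" if "0 < m" "0 < n" for m n
    using delta_class_S_to_minor[OF that S_ring_closed(1)[of c]] by simp
  then have "const_infty c = (\<Union>i \<in> idx_pairs. xi_class (pconst c :: (maya, 'k) mpoly))"
    unfolding const_infty_def by (intro SUP_cong refl) (auto simp: idx_pairs_iff)
  moreover have "(1, 1) \<in> idx_pairs"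
    by (simp add: idx_pairs_iff)
  ultimately show ?thesis by blast
qed

lemma d_infty_eq: "d_infty a = xi_class (pvar a :: (maya, 'k::idom) mpoly)"
proof -
  have *: "delta_class m n (d_maya m a) = xi_class (pvar a :: (maya, 'k::idom) mpoly)"
    if "0 < m" "0 < n" "a \<in> maya_type m n" for m n
    using delta_class_S_to_minor[OF that(1,2), of "pvar a"] that by (simp add: carrier_S_ring)
  obtain m n where "0 < m" "0 < n" "a \<in> maya_type m n"
    using obtain_S_ring[of "pvar a :: (maya, 'k) mpoly"] by (auto simp: carrier_S_ring)
  with * show ?thesis
    unfolding d_infty_def by (auto simp: idx_pairs_iff)
qed

lemma delta_infty_one: "\<one>\<^bsub>delta_infty\<^esub> = xi_class (1 :: (maya, 'k::idom) mpoly)"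
  using const_infty_eq[of "1 :: 'k"]
  by (simp add: delta_infty_def dir_limit_def Let_def const_infty_def delta_class_def split_def)

lemma delta_infty_zero: "\<zero>\<^bsub>delta_infty\<^esub> = xi_class (0 :: (maya, 'k::idom) mpoly)"
  using const_infty_eq[of "0 :: 'k"]
  by (simp add: delta_infty_def dir_limit_def Let_def const_infty_def delta_class_def split_def)

lemma carrier_delta_infty: "carrier delta_infty = range (xi_class :: (maya, 'k::idom) mpoly \<Rightarrow> _)"
proof -
  have "carrier delta_infty =
      (\<Union>(m, n) \<in> idx_pairs. delta_class m n ` carrier (minor_alg m n :: (int \<times> int, 'k) mpoly ring))"
    by (auto simp: delta_infty_def dir_limit_def Let_def delta_class_def)
  also have "\<dots> = (\<Union>(m, n) \<in> idx_pairs. xi_class ` carrier (S_ring m n :: (maya, 'k) mpoly ring))"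
  proof (intro SUP_cong refl, clarify)
    fix m n assume "(m, n) \<in> idx_pairs"
    then have "0 < m" "0 < n" by (auto simp: idx_pairs_iff)
    then show "delta_class m n ` carrier (minor_alg m n) = xi_class ` (carrier (S_ring m n) :: (maya, 'k) mpoly set)"
      unfolding S_to_minor_image[OF \<open>0 < m\<close>, symmetric] image_image
      by (intro image_cong refl delta_class_S_to_minor)
  qed
  also have "\<dots> = range xi_class"
  proof (intro subset_antisym subsetI)
    fix z assume "z \<in> range (xi_class :: (maya, 'k) mpoly \<Rightarrow> _)"
    then obtain p :: "(maya, 'k) mpoly" where "z = xi_class p"
      by blast
    moreover obtain m n where "0 < m" "0 < n" "p \<in> carrier (S_ring m n)"
      by (rule obtain_S_ring)
    ultimately show "z \<in> (\<Union>(m, n) \<in> idx_pairs. xi_class ` carrier (S_ring m n :: (maya, 'k) mpoly ring))"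
      by (intro UN_I[of "(m, n)"]) (simp_all add: idx_pairs_iff)
  qed blast
  finally show ?thesis .
qed

lemma xi_ring_simps [simp]:
  "carrier xi_ring = UNIV" "mult xi_ring = (*)" "one xi_ring = 1" "zero xi_ring = 0" "add xi_ring = (+)"
  by (simp_all add: xi_ring_def)

theorem xi_class_induces_iso:
  "induces_ring_iso xi_class (xi_ring :: (maya, 'k::idom) mpoly ring) P_infty delta_infty"
proof (rule induces_ring_isoI)
  show ring: "ring (xi_ring :: (maya, 'k) mpoly ring)"
    unfolding xi_ring_def by (rule ring_poly_ring)
  show hom: "xi_class \<in> Ring.ring_hom (xi_ring :: (maya, 'k) mpoly ring) delta_infty"
    by (rule ring_hom_memI) (auto simp: delta_infty_mult delta_infty_add delta_infty_one carrier_delta_infty)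
  \<comment> \<open>The ring axioms for the direct limit come for free: its carrier and zero are
    those of the image of the polynomial ring under a homomorphism, and such an image is a
    ring.\<close>
  have "delta_infty\<lparr>carrier := xi_class ` carrier xi_ring, zero := xi_class \<zero>\<^bsub>xi_ring\<^esub>\<rparr> =
      (delta_infty :: ((nat \<times> nat) \<times> (int \<times> int, 'k) mpoly) set ring)"
    by (simp flip: carrier_delta_infty delta_infty_zero)
  then show "ring (delta_infty :: ((nat \<times> nat) \<times> (int \<times> int, 'k) mpoly) set ring)"
    using ring.ring_hom_imp_img_ring[OF ring hom] by simp
  show "xi_class ` carrier (xi_ring :: (maya, 'k) mpoly ring) = carrier delta_infty"
    by (simp add: carrier_delta_infty)
  show "P_infty = a_kernel (xi_ring :: (maya, 'k) mpoly ring) delta_infty xi_class"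
    by (auto simp: a_kernel_def' delta_infty_zero xi_class_eq_iff)
qed

theorem mainTheorem3:
  shows
    "(\<forall>a. nat_map_hat (xi_hat_var a) =
        (d_hat a :: nat \<times> nat \<Rightarrow> (int \<times> int, 'k::{alg_closed_field, field_char_0}) mpoly)) \<and>
     induces_ring_iso nat_map_hat (xi_hat :: (nat \<times> nat \<Rightarrow> (maya, 'k) mpoly) ring) P_hat delta_hat \<and>
     (\<exists>\<nu>. (\<forall>c::'k. \<nu> (pconst c) = const_infty c) \<and>
        (\<forall>a. \<nu> (pvar a) = d_infty a) \<and>
        induces_ring_iso \<nu> (xi_ring :: (maya, 'k) mpoly ring) P_infty delta_infty)"
proof (intro conjI exI allI)
  fix a :: maya and c :: 'k
  show "nat_map_hat (xi_hat_var a) = (d_hat a :: nat \<times> nat \<Rightarrow> (int \<times> int, 'k) mpoly)"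
    by (rule nat_map_hat_var)
  show "induces_ring_iso nat_map_hat (xi_hat :: (nat \<times> nat \<Rightarrow> (maya, 'k) mpoly) ring) P_hat delta_hat"
    by (rule nat_map_hat_induces_iso)
  \<comment> \<open>The witness for \<nu> was left open by \<open>exI\<close> and becomes
    \<open>xi_class\<close> here.\<close>
  show "xi_class (pconst c) = const_infty c" "xi_class (pvar a :: (maya, 'k) mpoly) = d_infty a"
    by (rule const_infty_eq[symmetric], rule d_infty_eq[symmetric])
  show "induces_ring_iso xi_class (xi_ring :: (maya, 'k) mpoly ring) P_infty delta_infty"
    by (rule xi_class_induces_iso)
qed

end
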